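(* Let $\mathcal{G}$ be a locally Schur positive graph of type $(n,N)$, let $1<i<n$, and suppose that the $(i-2,N)$-restriction of $\mathcal{G}$ is a dual equivalence graph and that the $(i,N)$-restriction of $\mathcal{G}$ satisfies dual equivalence axiom (ax4). Then $W_i^0(\mathcal{G})=W_i(\mathcal{G})$, and for every $w\in W_i(\mathcal{G})$ the graph $\varphi_i^w(\mathcal{G})$ is defined and $W_i(\varphi_i^w(\mathcal{G}))$ is a proper subset of $W_i(\mathcal{G})$.
   Context: For $\sigma\in\{\pm1\}^{m-1}$, $Q_\sigma(X)=\sum x_{i_1}\cdots x_{i_m}$ over $i_1\le\cdots\le i_m$ with $i_j<i_{j+1}$ whenever $\sigma_j=-1$; $s_\lambda$ is the Schur function. A signed, colored graph of type $(n,N)$ is $(V,\sigma,E_2\cup\cdots\cup E_{n-1})$ with $V$ finite, $\sigma:V\to\{\pm1\}^{N-1}$ ($\sigma(v)_j$ the $j$-th entry), and for $1<i<n$ a set $E_i$ of $2$-element subsets of $V$ ($i$-edges); $E_j$ is empty for other $j$. If $w$ lies in a unique $i$-edge $\{w,x\}$, write $x=E_i(w)$ and say $w$ has an $i$-neighbour; $E_iE_j(w)=E_i(E_j(w))$. The $(m,M)$-restriction is the graph of type $(m,M)$ on $V$ with signatures truncated to the first $M-1$ entries and edges $E_i$, $1<i<m$. Axioms: (ax1) $\sigma(w)_{i-1}=-\sigma(w)_i$ iff $w$ lies in some $i$-edge, and then in a unique one. (ax2) if $\{w,x\}\in E_i$ then $\sigma(w)_j=-\sigma(x)_j$ for $j=i-1,i$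 and $\sigma(w)_h=\sigma(x)_h$ for $h<i-2$, $h>i+1$. (ax3) if $\{w,x\}\in E_i$ and $\sigma(w)_{i-2}=-\sigma(x)_{i-2}$ then $\sigma(w)_{i-2}=-\sigma(w)_{i-1}$; if $\sigma(w)_{i+1}=-\sigma(x)_{i+1}$ then $\sigma(w)_{i+1}=-\sigma(w)_i$. (ax4) every connected component of $(V,E_{i-1}\cup E_i)$ is, as an edge-coloured graph, a single vertex, a path $p$–$q$–$r$ with $\{p,q\}\in E_{i-1},\{q,r\}\in E_i$, or two vertices $p,q$ with $\{p,q\}\in E_{i-1}\cap E_i$; and every connected component of $(V,E_{i-2}\cup E_{i-1}\cup E_i)$ is exactly one of: a single vertex; a path $p$–$q$–$r$–$s$ with edges of colours $i-2,i-1,i$ in order; five vertices $a,b,c,d,e$ with $\{a,b\}\in E_{i-2}\cap E_{i-1}$, $\{b,c\}\in E_i$, $\{c,d\}\in E_{i-2}$, $\{d,e\}\in E_{i-1}\cap E_i$; six vertices $u,v,w',x,y,z$ with $\{u,v\}\in E_{i-1}$, $\{v,w'\}\in E_{i-2}$, $\{v,x\}\in E_i$, $\{w',y\}\in E_i$, $\{x,y\}\in E_{i-2}$, $\{y,z\}\in E_{i-1}$. (ax5) if $\{w,x\}\in E_i$, $\{x,y\}\in E_j$, $|i-j|\ge3$, there is $v$ with $\{w,v\}\in E_j$, $\{v,y\}\in E_i$. (ax6) any two vertices of a connected component of $(V,E_2\cup\cdots\cup E_i)$ are joined by a path using at most one $E_i$ edge. A dual equivalence graph of type $(n,N)$ has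 $n\le N$ and satisfies (ax1)–(ax6). For $m\ge4$, $m-2<i<n$ and a connected component $\mathcal{C}$ of $(V,E_{i-(m-3)}\cup\cdots\cup E_i)$, the restricted degree-$m$ generating function is $\sum_{v\in\mathcal{C}}Q_{(\sigma(v)_{i-(m-2)},\dots,\sigma(v)_i)}$; $\mathrm{LSP}_m$ means all of these are symmetric and Schur positive. Locally Schur positive: (ax1),(ax2),(ax3),(ax5) and $\mathrm{LSP}_4,\mathrm{LSP}_5,\mathrm{LSP}_6$. $w$ has $i$-type W if $w$ has an $(i-1)$-neighbour and $\sigma(w)_i=-\sigma(E_{i-1}(w))_i$. $w$ has a flat $i$-edge if it has an $i$-neighbour and $\sigma(w)_{i-2}=\sigma(E_i(w))_{i-2}$. A non-flat $i$-chain is a sequence $(w_1,\dots,w_{2h})$ of distinct vertices with $w_{2j-1}=E_i(w_{2j})$ ($1\le j\le h$) and $w_{2j+1}=E_{i-1}(w_{2j})$ ($1\le j<h$); $W_i(\mathcal{G})$ is the set of $w=w_j$ for some non-flat $i$-chain and $1<j<2h$. The $k$-package of $w$ is the connected component containing $w$ of $(V,E_2\cup\cdots\cup E_{k-3}\cup E_{k+3}\cup\cdots\cup E_{n-1})$. $W_i^0(\mathcal{G})=\{w\in W_i(\mathcal{G}):$ every vertex of the $(i-1)$-package of $w$ has a flat $(i-1)$-edge$\}$. An isomorphism between $i$-packages $P,P'$ is a bijection $f:P\to P'$ preserving and reflecting $E_j$-edges for $j\in\{2,\dots,i-3\}\cup\{i+3,\dots,n-1\}$ and with $\sigma(f(a))_j=\sigma(a)_j$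 for $j\le i-3$ and $j\ge i+2$ (it is determined by the image of one vertex). The map $\varphi_i^w$: for $w\in W_i^0(\mathcal{G})$ let $u=E_{i-1}(w)$ and let $\phi$ be the isomorphism from the $i$-package of $w$ onto that of $u$ with $\phi(w)=u$ (when it exists; $\phi$ also denotes its inverse). For each $v$ having an $i$-neighbour set $\varphi_i^w(v)=\phi(v)$ if $v$ lies in the $i$-package of $w$ or of $u$; $\varphi_i^w(v)=E_i\phi E_i(v)$ if $E_i(v)$ lies in the $i$-package of $w$ or of $u$; and $\varphi_i^w(v)=E_i(v)$ otherwise. Then $\varphi_i^w(\mathcal{G})$ is the graph obtained from $\mathcal{G}$ by replacing $E_i$ with $E_i'=\{\{v,\varphi_i^w(v)\}: v \text{ has an } i\text{-neighbour}\}$, all other data unchanged. *)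

theory Defs
  imports Main "HOL-Library.Multiset" "HOL-Library.FuncSet"
begin

section \<open>Symmetric and quasisymmetric functions\<close>

text \<open>A formal power series with integer coefficients in the variables \<open>x\<^sub>0, x\<^sub>1, \<dots>\<close> is given by
  its coefficients; the monomial \<open>x\<^bsub>i1\<^esub> \<cdots> x\<^bsub>im\<^esub>\<close> is the multiset \<open>{#i1, \<dots>, im#}\<close>.\<close>

type_synonym power_series = "nat multiset \<Rightarrow> int"

text \<open>Lists are indexed from 0, so \<open>s ! j\<close> governs the step from \<open>is ! j\<close> to \<open>is ! Suc j\<close>.\<close>

definition fund_quasisym :: "int list \<Rightarrow> power_series" where
  "fund_quasisym s M = int (card {is :: nat list.
     length is = length s + 1 \<and> sorted is \<and>
     (\<forall>j < length s. s ! j = -1 \<longrightarrow> is ! j < is ! Suc j) \<and>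
     mset is = M})"

definition is_partition :: "nat list \<Rightarrow> bool" where
  "is_partition lam \<longleftrightarrow> sorted_wrt (\<ge>) lam \<and> 0 \<notin> set lam"

definition cells :: "nat list \<Rightarrow> (nat \<times> nat) set" where
  "cells lam = {(r, c). r < length lam \<and> c < lam ! r}"

text \<open>Fillings are taken extensional on the diagram, so that each tableau is counted once.\<close>

definition ssyt :: "nat list \<Rightarrow> (nat \<times> nat \<Rightarrow> nat) set" where
  "ssyt lam = {T \<in> extensional (cells lam).
     (\<forall>r c. (r, c) \<in> cells lam \<and> (r, Suc c) \<in> cells lam \<longrightarrow> T (r, c) \<le> T (r, Suc c)) \<and>
     (\<forall>r c. (r, c) \<in> cells lam \<and> (Suc r, c) \<in> cells lam \<longrightarrow> T (r, c) < T (Suc r, c))}"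

definition schur :: "nat list \<Rightarrow> power_series" where
  "schur lam M = int (card {T \<in> ssyt lam. image_mset T (mset_set (cells lam)) = M})"

definition symmetric_series :: "power_series \<Rightarrow> bool" where
  "symmetric_series f \<longleftrightarrow> (\<forall>p :: nat \<Rightarrow> nat. bij p \<longrightarrow> (\<forall>M. f (image_mset p M) = f M))"

definition schur_positive :: "power_series \<Rightarrow> bool" where
  "schur_positive f \<longleftrightarrow> (\<exists>c :: nat list \<Rightarrow> nat.
     finite {lam. c lam \<noteq> 0} \<and> (\<forall>lam. c lam \<noteq> 0 \<longrightarrow> is_partition lam) \<and>
     (\<forall>M. f M = (\<Sum>lam | c lam \<noteq> 0. int (c lam) * schur lam M)))"


section \<open>Signed, colored graphs\<close>

text \<open>\<open>sig G v j\<close> is the \<open>j\<close>-th entry of the signature of \<open>v\<close>, for \<open>1 \<le> j \<le> N - 1\<close>; outside this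
  range there is no entry and the function is 0. Below, every condition on signatures is
  required only for entries that exist.\<close>

record 'v scgraph =
  verts :: "'v set"
  sig :: "'v \<Rightarrow> nat \<Rightarrow> int"
  edges :: "nat \<Rightarrow> 'v set set"
  type_n :: nat
  type_N :: nat

definition signed_colored_graph :: "'v scgraph \<Rightarrow> bool" where
  "signed_colored_graph G \<longleftrightarrow>
     finite (verts G) \<and>
     (\<forall>v \<in> verts G. \<forall>j. if 1 \<le> j \<and> j < type_N G then sig G v j \<in> {1, -1} else sig G v j = 0) \<and>
     (\<forall>i. \<forall>e \<in> edges G i. e \<subseteq> verts G \<and> card e = 2) \<and>
     (\<forall>i. \<not> (1 < i \<and> i < type_n G) \<longrightarrow> edges G i = {})"

definition restriction :: "nat \<Rightarrow> nat \<Rightarrow> 'v scgraph \<Rightarrow> 'v scgraph" where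
  "restriction m M G = G\<lparr>
     sig := (\<lambda>v j. if 1 \<le> j \<and> j < M then sig G v j else 0),
     edges := (\<lambda>i. if 1 < i \<and> i < m then edges G i else {}),
     type_n := m, type_N := M\<rparr>"

definition has_nbr :: "'v scgraph \<Rightarrow> nat \<Rightarrow> 'v \<Rightarrow> bool" where
  "has_nbr G i w \<longleftrightarrow> (\<exists>!e. e \<in> edges G i \<and> w \<in> e)"

definition nbr :: "'v scgraph \<Rightarrow> nat \<Rightarrow> 'v \<Rightarrow> 'v" where
  "nbr G i w = (THE x. {w, x} \<in> edges G i)"

definition component_of :: "'v scgraph \<Rightarrow> nat set \<Rightarrow> 'v \<Rightarrow> 'v set" where
  "component_of G J v = {x \<in> verts G. (v, x) \<in> {(a, b). \<exists>j \<in> J. {a, b} \<in> edges G j}\<^sup>*}"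

definition is_component :: "'v scgraph \<Rightarrow> nat set \<Rightarrow> 'v set \<Rightarrow> bool" where
  "is_component G J C \<longleftrightarrow> (\<exists>v \<in> verts G. C = component_of G J v)"

definition edges_in :: "'v scgraph \<Rightarrow> nat \<Rightarrow> 'v set \<Rightarrow> 'v set set" where
  "edges_in G j C = {e \<in> edges G j. e \<subseteq> C}"


section \<open>Dual equivalence axioms\<close>

definition ax1 :: "'v scgraph \<Rightarrow> bool" where
  "ax1 G \<longleftrightarrow> (\<forall>i. 1 < i \<and> i < type_n G \<longrightarrow> (\<forall>w \<in> verts G.
     (sig G w (i - 1) = - sig G w i \<longleftrightarrow> (\<exists>e \<in> edges G i. w \<in> e)) \<and>
     ((\<exists>e \<in> edges G i. w \<in> e) \<longrightarrow> (\<exists>!e. e \<in> edges G i \<and> w \<in> e))))"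

definition ax2 :: "'v scgraph \<Rightarrow> bool" where
  "ax2 G \<longleftrightarrow> (\<forall>i w x. 1 < i \<and> i < type_n G \<and> {w, x} \<in> edges G i \<longrightarrow>
     sig G w (i - 1) = - sig G x (i - 1) \<and> sig G w i = - sig G x i \<and>
     (\<forall>h. 1 \<le> h \<and> h < type_N G \<and> (h + 2 < i \<or> i + 1 < h) \<longrightarrow> sig G w h = sig G x h))"

definition ax3 :: "'v scgraph \<Rightarrow> bool" where
  "ax3 G \<longleftrightarrow> (\<forall>i w x. 1 < i \<and> i < type_n G \<and> {w, x} \<in> edges G i \<longrightarrow>
     (3 \<le> i \<and> sig G w (i - 2) = - sig G x (i - 2) \<longrightarrow> sig G w (i - 2) = - sig G w (i - 1)) \<and>
     (i + 1 < type_N G \<and> sig G w (i + 1) = - sig G x (i + 1) \<longrightarrow>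
        sig G w (i + 1) = - sig G w i))"

definition two_color_component :: "'v scgraph \<Rightarrow> nat \<Rightarrow> 'v set \<Rightarrow> bool" where
  "two_color_component G i C \<longleftrightarrow>
     (\<exists>p. C = {p}) \<or>
     (\<exists>p q r. distinct [p, q, r] \<and> C = {p, q, r} \<and>
        edges_in G (i - 1) C = {{p, q}} \<and> edges_in G i C = {{q, r}}) \<or>
     (\<exists>p q. distinct [p, q] \<and> C = {p, q} \<and>
        edges_in G (i - 1) C = {{p, q}} \<and> edges_in G i C = {{p, q}})"

definition three_color_component :: "'v scgraph \<Rightarrow> nat \<Rightarrow> 'v set \<Rightarrow> bool" where
  "three_color_component G i C \<longleftrightarrow>
     (\<exists>p. C = {p}) \<or>
     (\<exists>p q r s. distinct [p, q, r, s] \<and> C = {p, q, r, s} \<and>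
        edges_in G (i - 2) C = {{p, q}} \<and>
        edges_in G (i - 1) C = {{q, r}} \<and>
        edges_in G i C = {{r, s}}) \<or>
     (\<exists>a b c d e. distinct [a, b, c, d, e] \<and> C = {a, b, c, d, e} \<and>
        edges_in G (i - 2) C = {{a, b}, {c, d}} \<and>
        edges_in G (i - 1) C = {{a, b}, {d, e}} \<and>
        edges_in G i C = {{b, c}, {d, e}}) \<or>
     (\<exists>u v w x y z. distinct [u, v, w, x, y, z] \<and> C = {u, v, w, x, y, z} \<and>
        edges_in G (i - 2) C = {{v, w}, {x, y}} \<and>
        edges_in G (i - 1) C = {{u, v}, {y, z}} \<and>
        edges_in G i C = {{v, x}, {w, y}})"

text \<open>The two clauses range over those \<open>i\<close> for which all the colors involved exist, i.e. lie
  strictly between 1 and \<open>n\<close>; no component of color 2 alone is constrained.\<close>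

definition ax4 :: "'v scgraph \<Rightarrow> bool" where
  "ax4 G \<longleftrightarrow>
     (\<forall>i C. 3 \<le> i \<and> i < type_n G \<and> is_component G {i - 1, i} C \<longrightarrow>
        two_color_component G i C) \<and>
     (\<forall>i C. 4 \<le> i \<and> i < type_n G \<and> is_component G {i - 2, i - 1, i} C \<longrightarrow>
        three_color_component G i C)"

definition ax5 :: "'v scgraph \<Rightarrow> bool" where
  "ax5 G \<longleftrightarrow> (\<forall>i j w x y. {w, x} \<in> edges G i \<and> {x, y} \<in> edges G j \<and> (i + 3 \<le> j \<or> j + 3 \<le> i) \<longrightarrow>
     (\<exists>v. {w, v} \<in> edges G j \<and> {v, y} \<in> edges G i))"

text \<open>An edge may carry several colors, so a path records the color used at each step.\<close>

definition colored_path :: "'v scgraph \<Rightarrow> nat set \<Rightarrow> 'v list \<Rightarrow> nat list \<Rightarrow> bool" where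
  "colored_path G J vs cs \<longleftrightarrow>
     length vs = length cs + 1 \<and> set vs \<subseteq> verts G \<and>
     (\<forall>k < length cs. cs ! k \<in> J \<and> {vs ! k, vs ! Suc k} \<in> edges G (cs ! k))"

definition ax6 :: "'v scgraph \<Rightarrow> bool" where
  "ax6 G \<longleftrightarrow> (\<forall>i C. 1 < i \<and> i < type_n G \<and> is_component G {2..i} C \<longrightarrow>
     (\<forall>x \<in> C. \<forall>y \<in> C. \<exists>vs cs. colored_path G {2..i} vs cs \<and> hd vs = x \<and> last vs = y \<and>
        count_list cs i \<le> 1))"

definition dual_equivalence_graph :: "'v scgraph \<Rightarrow> bool" where
  "dual_equivalence_graph G \<longleftrightarrow> signed_colored_graph G \<and> type_n G \<le> type_N G \<and>
     ax1 G \<and> ax2 G \<and> ax3 G \<and> ax4 G \<and> ax5 G \<and> ax6 G"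


section \<open>Local Schur positivity\<close>

definition restricted_gf :: "'v scgraph \<Rightarrow> nat \<Rightarrow> nat \<Rightarrow> 'v set \<Rightarrow> power_series" where
  "restricted_gf G m i C M = (\<Sum>v \<in> C. fund_quasisym (map (sig G v) [i - (m - 2)..<Suc i]) M)"

definition LSP :: "nat \<Rightarrow> 'v scgraph \<Rightarrow> bool" where
  "LSP m G \<longleftrightarrow> (\<forall>i C. m - 2 < i \<and> i < type_n G \<and> is_component G {i - (m - 3)..i} C \<longrightarrow>
     symmetric_series (restricted_gf G m i C) \<and> schur_positive (restricted_gf G m i C))"

text \<open>The condition \<open>n \<le> N\<close> is implicit in axiom 1, which refers to the entries of the
  signature up to position \<open>n - 1\<close>.\<close>

definition locally_schur_positive :: "'v scgraph \<Rightarrow> bool" where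
  "locally_schur_positive G \<longleftrightarrow> signed_colored_graph G \<and> type_n G \<le> type_N G \<and>
     ax1 G \<and> ax2 G \<and> ax3 G \<and> ax5 G \<and> LSP 4 G \<and> LSP 5 G \<and> LSP 6 G"


section \<open>Non-flat chains and packages\<close>

text \<open>For \<open>i = 2\<close> there is no entry at position \<open>i - 2\<close>, and every 2-edge counts as flat.\<close>

definition has_flat_edge :: "'v scgraph \<Rightarrow> nat \<Rightarrow> 'v \<Rightarrow> bool" where
  "has_flat_edge G i w \<longleftrightarrow> has_nbr G i w \<and>
     (3 \<le> i \<longrightarrow> sig G w (i - 2) = sig G (nbr G i w) (i - 2))"

text \<open>The chain \<open>(w\<^sub>1, \<dots>, w\<^bsub>2h\<^esub>)\<close> is the function \<open>c\<close> on \<open>{1..2h}\<close>.\<close>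

definition nonflat_chain :: "'v scgraph \<Rightarrow> nat \<Rightarrow> nat \<Rightarrow> (nat \<Rightarrow> 'v) \<Rightarrow> bool" where
  "nonflat_chain G i h c \<longleftrightarrow>
     c ` {1..2 * h} \<subseteq> verts G \<and> inj_on c {1..2 * h} \<and>
     (\<forall>j. 1 \<le> j \<and> j \<le> h \<longrightarrow>
        has_nbr G i (c (2 * j)) \<and> c (2 * j - 1) = nbr G i (c (2 * j))) \<and>
     (\<forall>j. 1 \<le> j \<and> j < h \<longrightarrow>
        has_nbr G (i - 1) (c (2 * j)) \<and> c (2 * j + 1) = nbr G (i - 1) (c (2 * j)))"

definition W :: "'v scgraph \<Rightarrow> nat \<Rightarrow> 'v set" where
  "W G i = {w. \<exists>h c j. nonflat_chain G i h c \<and> 1 < j \<and> j < 2 * h \<and> w = c j}"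

definition package_colors :: "'v scgraph \<Rightarrow> nat \<Rightarrow> nat set" where
  "package_colors G k = {j. 1 < j \<and> j < type_n G \<and> (j + 3 \<le> k \<or> k + 3 \<le> j)}"

definition package :: "'v scgraph \<Rightarrow> nat \<Rightarrow> 'v \<Rightarrow> 'v set" where
  "package G k w = component_of G (package_colors G k) w"

definition W0 :: "'v scgraph \<Rightarrow> nat \<Rightarrow> 'v set" where
  "W0 G i = {w \<in> W G i. \<forall>v \<in> package G (i - 1) w. has_flat_edge G (i - 1) v}"

definition package_iso :: "'v scgraph \<Rightarrow> nat \<Rightarrow> 'v set \<Rightarrow> 'v set \<Rightarrow> ('v \<Rightarrow> 'v) \<Rightarrow> bool" where
  "package_iso G i P P' f \<longleftrightarrow>
     f \<in> extensional P \<and> bij_betw f P P' \<and>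
     (\<forall>j \<in> package_colors G i. \<forall>a \<in> P. \<forall>b \<in> P.
        {a, b} \<in> edges G j \<longleftrightarrow> {f a, f b} \<in> edges G j) \<and>
     (\<forall>a \<in> P. \<forall>j. 1 \<le> j \<and> j < type_N G \<and> (j + 3 \<le> i \<or> i + 2 \<le> j) \<longrightarrow>
        sig G (f a) j = sig G a j)"


section \<open>The map \<open>\<phi>\<^sub>i\<^sup>w\<close>\<close>

definition is_phi_iso :: "'v scgraph \<Rightarrow> nat \<Rightarrow> 'v \<Rightarrow> ('v \<Rightarrow> 'v) \<Rightarrow> bool" where
  "is_phi_iso G i w f \<longleftrightarrow>
     package_iso G i (package G i w) (package G i (nbr G (i - 1) w)) f \<and> f w = nbr G (i - 1) w"

definition phi_iso :: "'v scgraph \<Rightarrow> nat \<Rightarrow> 'v \<Rightarrow> 'v \<Rightarrow> 'v" where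
  "phi_iso G i w = (THE f. is_phi_iso G i w f)"

definition phi_dom :: "'v scgraph \<Rightarrow> nat \<Rightarrow> 'v \<Rightarrow> 'v set" where
  "phi_dom G i w = package G i w \<union> package G i (nbr G (i - 1) w)"

text \<open>The isomorphism together with its inverse. (By axiom 2 the entry at position \<open>i - 1\<close> is
  constant on an \<open>i\<close>-package and is changed by an \<open>(i - 1)\<close>-edge, so the two packages are
  disjoint.)\<close>

definition phi_swap :: "'v scgraph \<Rightarrow> nat \<Rightarrow> 'v \<Rightarrow> 'v \<Rightarrow> 'v" where
  "phi_swap G i w v =
     (if v \<in> package G i w then phi_iso G i w v
      else inv_into (package G i w) (phi_iso G i w) v)"

definition phi_map :: "'v scgraph \<Rightarrow> nat \<Rightarrow> 'v \<Rightarrow> 'v \<Rightarrow> 'v" where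
  "phi_map G i w v =
     (if v \<in> phi_dom G i w then phi_swap G i w v
      else if nbr G i v \<in> phi_dom G i w then nbr G i (phi_swap G i w (nbr G i v))
      else nbr G i v)"

definition phi_graph :: "'v scgraph \<Rightarrow> nat \<Rightarrow> 'v \<Rightarrow> 'v scgraph" where
  "phi_graph G i w = G\<lparr>edges := (edges G)(i := {{v, phi_map G i w v} | v. has_nbr G i v})\<rparr>"

text \<open>The graph is defined if \<open>w\<close> is admissible, the isomorphism exists uniquely, the outer
  \<open>i\<close>-neighbour in the second case of the map always exists, and the new edge sets
  again form a signed, colored graph.\<close>

definition phi_defined :: "'v scgraph \<Rightarrow> nat \<Rightarrow> 'v \<Rightarrow> bool" where
  "phi_defined G i w \<longleftrightarrow>
     w \<in> W0 G i \<and> (\<exists>!f. is_phi_iso G i w f) \<and>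
     (\<forall>v. has_nbr G i v \<and> v \<notin> phi_dom G i w \<and> nbr G i v \<in> phi_dom G i w \<longrightarrow>
        has_nbr G i (phi_swap G i w (nbr G i v))) \<and>
     signed_colored_graph (phi_graph G i w)"

end

theory Submission
  imports Defs
begin

text \<open>Write \<open>e j\<close> for the involution along color \<open>j\<close>. A change of the entry \<open>j\<close> along color \<open>j - 1\<close>, or
  of the entry \<open>j - 2\<close> along color \<open>j\<close>, occurs exactly on a double edge of colors \<open>j - 1\<close> and \<open>j\<close>, by
  (ax4). Hence a non-flat \<open>(i - 1)\<close>-edge cannot change the entry \<open>i\<close>, as an edge between two vertices of
  \<open>W\<close> does.

  No tableaux are needed for the isomorphism of \<open>i\<close>-packages. Compare vertices by the signatures
  seen along all words in the colors up to \<open>c\<close>. Simultaneous induction on \<open>c\<close> shows that this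
  comparison up to color \<open>c - 1\<close>, with entries up to \<open>c\<close>, already determines it up to color \<open>c\<close>, and that
  distinct vertices of one component are told apart by it, even by colors and entries up to \<open>c - 1\<close> (a
  multiplicity-free branching rule); (ax6) reduces words to those with at most one letter \<open>c\<close>. Flatness
  makes \<open>w\<close> and \<open>u = E\<^bsub>i-1\<^esub>(w)\<close> indistinguishable, so acting by words on both of them defines the
  isomorphism.

  Finally, no vertex of the two packages lies on a double edge of colors \<open>i - 1\<close> and \<open>i\<close>. So the new
  \<open>i\<close>-edges destroy no such double edge, hence create no new element of \<open>W\<close>, while \<open>{w, u}\<close> becomes
  one.\<close>

section \<open>Words in the moves\<close>

definition far :: "nat \<Rightarrow> nat \<Rightarrow> bool" where
  "far j k \<longleftrightarrow> j + 3 \<le> k \<or> k + 3 \<le> j"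

text \<open>Each color acts as a total involution, a fixed point meaning that there is no edge;
  paths become words, and (ax5) becomes commutation of far colors. In \<open>three_colors\<close>
  the first alternative is the six-vertex component, the second the vertices \<open>b\<close> and
  \<open>c\<close> of the five-vertex one. The bound \<open>c + 2 < i\<close> in
  \<open>one_top_step\<close> is the range of colors of the
  \<open>(i - 2, N)\<close>-restriction.\<close>

locale flip_graph =
  fixes V :: "'v set" and s :: "'v \<Rightarrow> nat \<Rightarrow> int" and e :: "nat \<Rightarrow> 'v \<Rightarrow> 'v" and n i :: nat
  assumes i_less: "i < n"
    and e_closed: "v \<in> V \<Longrightarrow> e j v \<in> V"
    and e_inv [simp]: "e j (e j v) = v"
    and move_iff: "v \<in> V \<Longrightarrow> 1 < j \<Longrightarrow> j < n \<Longrightarrow> e j v \<noteq> v \<longleftrightarrow> s v (j - 1) = - s v j"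
    and e_trivial: "\<not> (1 < j \<and> j < n) \<Longrightarrow> e j v = v"
    and s_sign: "v \<in> V \<Longrightarrow> 1 \<le> h \<Longrightarrow> h < n \<Longrightarrow> s v h = 1 \<or> s v h = - 1"
    and s_flip: "v \<in> V \<Longrightarrow> e j v \<noteq> v \<Longrightarrow> s (e j v) (j - 1) = - s v (j - 1) \<and> s (e j v) j = - s v j"
    and s_far: "v \<in> V \<Longrightarrow> h + 2 < j \<or> j + 1 < h \<Longrightarrow> s (e j v) h = s v h"
    and e_commute: "far j k \<Longrightarrow> e j (e k v) = e k (e j v)"
    and double_up: "v \<in> V \<Longrightarrow> 3 \<le> j \<Longrightarrow> j < i \<Longrightarrow> s (e (j - 1) v) j \<noteq> s v j \<Longrightarrow> e j v = e (j - 1) v"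
    and double_down: "v \<in> V \<Longrightarrow> 3 \<le> j \<Longrightarrow> j < i \<Longrightarrow> s (e j v) (j - 2) \<noteq> s v (j - 2) \<Longrightarrow>
      e j v = e (j - 1) v"
    and three_colors: "v \<in> V \<Longrightarrow> 4 \<le> j \<Longrightarrow> j < i \<Longrightarrow> e (j - 2) v \<noteq> v \<Longrightarrow> e j v \<noteq> v \<Longrightarrow>
      e j v \<noteq> e (j - 1) v \<Longrightarrow>
      (e (j - 2) (e j v) = e j (e (j - 2) v) \<and> e j (e (j - 2) v) \<notin> {e (j - 2) v, e (j - 1) (e (j - 2) v)}) \<or>
      (e j (e (j - 2) v) \<in> {e (j - 2) v, e (j - 1) (e (j - 2) v)} \<and>
       e j (e (j - 2) (e j v)) \<in> {e (j - 2) (e j v), e (j - 1) (e (j - 2) (e j v))} \<and>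
       s (e (j - 2) (e j v)) (j - 1) = s (e (j - 2) v) (j - 1))"
    and one_top_step: "v \<in> V \<Longrightarrow> 2 \<le> c \<Longrightarrow> c + 2 < i \<Longrightarrow> ws \<in> lists {2..c} \<Longrightarrow>
      (\<exists>as \<in> lists {2..c - 1}. foldr e ws v = foldr e as v) \<or>
      (\<exists>as \<in> lists {2..c - 1}. \<exists>bs \<in> lists {2..c - 1}. foldr e ws v = foldr e as (e c (foldr e bs v)))"
begin

abbreviation walk :: "nat list \<Rightarrow> 'v \<Rightarrow> 'v" where
  "walk ws v \<equiv> foldr e ws v"

text \<open>Indistinguishability by signatures: \<open>c\<close> bounds the letters of the words
  tried, \<open>h\<close> the entries read. For \<open>c\<close> at most 1 only the empty word is
  tried, which gives a truncated \<open>c - 3\<close> its meaning.\<close>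

definition agree :: "nat \<Rightarrow> nat \<Rightarrow> 'v \<Rightarrow> 'v \<Rightarrow> bool" where
  "agree c h v v' \<longleftrightarrow> (\<forall>ws \<in> lists {2..c}. \<forall>k \<in> {1..h}. s (walk ws v) k = s (walk ws v') k)"

text \<open>Plays the role of uniqueness of extensions of dual equivalence graphs: what is seen
  below color \<open>c\<close>, entry \<open>c\<close> included, decides how the component continues
  through color \<open>c\<close>.\<close>

definition extendable :: "nat \<Rightarrow> bool" where
  "extendable c \<longleftrightarrow> (\<forall>v \<in> V. \<forall>v' \<in> V. agree (c - 1) c v v' \<longrightarrow> agree c c v v')"

text \<open>In tableau terms: a component in the colors 2 to \<open>c\<close> consists of the
  standard tableaux of one shape with \<open>c + 1\<close> cells, and the comparison sees a tableau
  without its largest entry. Removing different corners leaves different shapes.\<close>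

definition rigid :: "nat \<Rightarrow> bool" where
  "rigid c \<longleftrightarrow> (\<forall>v \<in> V. \<forall>ws \<in> lists {2..c}. agree (c - 1) (c - 1) v (walk ws v) \<longrightarrow> walk ws v = v)"

lemma walk_closed [simp]: "v \<in> V \<Longrightarrow> walk ws v \<in> V"
  by (induction ws) (auto intro: e_closed)

lemma walk_rev [simp]: "walk (rev ws) (walk ws v) = v"
  by (induction ws) auto

lemma walk_rev' [simp]: "walk ws (walk (rev ws) v) = v"
  using walk_rev[of "rev ws" v] by simp

lemma walk_commute: "(\<And>j. j \<in> set ws \<Longrightarrow> far j k) \<Longrightarrow> e k (walk ws v) = walk ws (e k v)"
proof (induction ws)
  case (Cons j ws)
  then show ?case using e_commute[of j k "walk ws v"] by simp
qed simp

lemma s_walk_far: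
  assumes "v \<in> V" "\<And>j. j \<in> set ws \<Longrightarrow> h + 2 < j \<or> j + 1 < h"
  shows "s (walk ws v) h = s v h"
  using assms(2) by (induction ws) (auto simp: s_far assms(1))

lemma move_cong:
  assumes "v \<in> V" "v' \<in> V" "s v (j - 1) = s v' (j - 1)" "s v j = s v' j"
  shows "e j v = v \<longleftrightarrow> e j v' = v'"
  using assms move_iff[of v j] move_iff[of v' j] e_trivial[of j v] e_trivial[of j v'] by auto

lemma move_imp: "e j v \<noteq> v \<Longrightarrow> 1 < j \<and> j < n"
  using e_trivial by blast

lemma sign_neq: "v \<in> V \<Longrightarrow> 1 \<le> h \<Longrightarrow> h < n \<Longrightarrow> s v h \<noteq> - s v h"
  using s_sign[of v h] by auto

text \<open>Each color flips its own two entries, so on a shared edge each color also performs the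
  flips of the other. This is the converse of \<open>double_up\<close> and
  \<open>double_down\<close>.\<close>

lemma double_flip:
  assumes "v \<in> V" "e (j - 1) v \<noteq> v" "e j v = e (j - 1) v"
  shows "s (e (j - 1) v) j \<noteq> s v j" "s (e j v) (j - 2) \<noteq> s v (j - 2)"
proof -
  have j: "1 < j - 1" "j < n" "e j v \<noteq> v" using assms move_imp[of "j-1" v] move_imp[of j v] by auto
  show "s (e (j - 1) v) j \<noteq> s v j"
    using s_flip[of v j] sign_neq[of v j] assms j by auto
  have "j - 1 - 1 = j - 2" by simp
  then show "s (e j v) (j - 2) \<noteq> s v (j - 2)"
    using s_flip[of v "j-1"] sign_neq[of v "j-2"] assms j by auto
qed

section \<open>Comparing vertices along words\<close>

lemma agreeD: "agree c h v v' \<Longrightarrow> ws \<in> lists {2..c} \<Longrightarrow> 1 \<le> k \<Longrightarrow> k \<le> h \<Longrightarrow> s (walk ws v) k = s (walk ws v') k"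
  by (auto simp: agree_def)

lemma agreeD0: "agree c h v v' \<Longrightarrow> 1 \<le> k \<Longrightarrow> k \<le> h \<Longrightarrow> s v k = s v' k"
  using agreeD[of c h v v' "[]"] by auto

lemma agree_walk:
  assumes "agree c h v v'" "ws \<in> lists {2..c}" shows "agree c h (walk ws v) (walk ws v')"
  unfolding agree_def
proof (intro ballI)
  fix us k assume "us \<in> lists {2..c}" "k \<in> {1..h}"
  then show "s (walk us (walk ws v)) k = s (walk us (walk ws v')) k"
    using agreeD[OF assms(1), of "us @ ws" k] assms(2) by auto
qed

lemma agree_mono: "agree c h v v' \<Longrightarrow> c' \<le> c \<Longrightarrow> h' \<le> h \<Longrightarrow> agree c' h' v v'"
  unfolding agree_def by (meson atLeastatMost_subset_iff in_mono lists_mono order_refl)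

lemma agree_sym: "agree c h v v' \<Longrightarrow> agree c h v' v"
  by (auto simp: agree_def)

lemma agree_trans: "agree c h v v' \<Longrightarrow> agree c h v' v'' \<Longrightarrow> agree c h v v''"
  by (auto simp: agree_def)

lemma reach_cases:
  assumes "v \<in> V" "c + 2 < i" "ws \<in> lists {2..c}"
  obtains as where "as \<in> lists {2..c - 1}" "walk ws v = walk as v"
  | as bs where "2 \<le> c" "as \<in> lists {2..c - 1}" "bs \<in> lists {2..c - 1}" "walk ws v = walk as (e c (walk bs v))"
proof (cases "2 \<le> c")
  case True then show ?thesis using one_top_step[OF assms(1) True assms(2,3)] that by blast
next
  case False
  then have "ws = []" using assms(3) by (cases ws) auto
  then show ?thesis using that(1)[of "[]"] by simp
qed

text \<open>Both endpoints from \<open>d'\<close> resemble the common endpoint from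
  \<open>d\<close>, hence each other, and rigidity identifies them. So a word can be shortened at
  \<open>d\<close> and \<open>d'\<close> simultaneously.\<close>

lemma walk_eq_transfer:
  assumes "rigid c" "d \<in> V" "d' \<in> V" "agree c c d d'" "ws \<in> lists {2..c}" "us \<in> lists {2..c}"
    "walk ws d = walk us d"
  shows "walk ws d' = walk us d'"
proof -
  let ?x = "walk us d'"
  have "agree c c ?x (walk ws d')"
    using agree_walk[OF assms(4,5)] agree_walk[OF assms(4,6)] assms(7) by (metis agree_sym agree_trans)
  then have "agree (c-1) (c-1) ?x (walk (ws @ rev us) ?x)"
    by (simp add: agree_mono)
  moreover have "ws @ rev us \<in> lists {2..c}" using assms(5,6) by auto
  ultimately have "walk (ws @ rev us) ?x = ?x" using assms(1,3) unfolding rigid_def by (metis walk_closed)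
  then show ?thesis by simp
qed

section \<open>Double edges and three-color components seen through the comparison\<close>

lemma nondouble_agree:
  assumes v: "v \<in> V" and c: "2 \<le> c" "c < i"
    and nd: "\<And>bs. bs \<in> lists {2..c - 3} \<Longrightarrow> e c (walk bs v) \<noteq> e (c - 1) (walk bs v)"
  shows "agree (c - 3) (c - 2) v (e c v)"
  unfolding agree_def
proof (intro ballI)
  fix bs k assume bs: "bs \<in> lists {2..c - 3}" and k: "k \<in> {1..c-2}"
  have com: "walk bs (e c v) = e c (walk bs v)"
    by (rule walk_commute[symmetric]) (use bs in \<open>auto simp: far_def in_lists_conv_set\<close>)
  \<comment> \<open>Color \<open>c\<close> is too far from the entries below \<open>c - 2\<close>,
    and it changes entry \<open>c - 2\<close> only across a double edge, which \<open>nd\<close>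
    excludes.\<close>
  show "s (walk bs v) k = s (walk bs (e c v)) k"
  proof (cases "k = c - 2")
    case True
    then have "3 \<le> c" using k by auto
    then show ?thesis using double_down[of "walk bs v" c] nd[OF bs] v c com True by (metis walk_closed)
  next
    case False
    then have "k + 2 < c \<or> c + 1 < k" using k by auto
    then show ?thesis using s_far[of "walk bs v" k c] v com by simp
  qed
qed

text \<open>Doubling is visible below color \<open>c\<close>: it is the change of entry
  \<open>c\<close> along color \<open>c - 1\<close>.\<close>

lemma agree_double:
  assumes V: "v \<in> V" "v' \<in> V" and c: "c < i" and ag: "agree (c - 1) c v v'"
    and mv: "e c v \<noteq> v"
    and d: "e c v = e (c - 1) v"
  shows "e c v' = e (c - 1) v'"
proof -
  have c3: "3 \<le> c" using d mv move_imp[of "c-1" v] by auto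
  have "s (e (c - 1) v) c \<noteq> s v c" using double_flip[of v c] d mv V by auto
  moreover have "s (e (c - 1) v) c = s (e (c - 1) v') c" "s v c = s v' c"
    using agreeD[OF ag, of "[c-1]" c] agreeD0[OF ag, of c] c3 by auto
  ultimately show ?thesis using double_up[of v' c] V c c3 by auto
qed

lemma agree_move:
  assumes V: "v \<in> V" "v' \<in> V" and ag: "agree k h v v'" and "c \<le> h"
  shows "e c v = v \<longleftrightarrow> e c v' = v'"
proof (cases "1 < c")
  case True then show ?thesis using move_cong[OF V] agreeD0[OF ag] assms by auto
next
  case False then show ?thesis using e_trivial by auto
qed

text \<open>Whether color \<open>c - 2\<close> acts depends on the entries \<open>c - 3\<close> and
  \<open>c - 2\<close>. Color \<open>c\<close> is too far to touch the first, and off a double edge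
  it preserves the second.\<close>

lemma flat_move:
  assumes "a \<in> V" "3 \<le> c" "c < i" "e c a \<noteq> e (c - 1) a"
  shows "e (c - 2) (e c a) = e c a \<longleftrightarrow> e (c - 2) a = a"
proof (cases "c = 3")
  case True then show ?thesis by (simp add: e_trivial)
next
  case False
  have "s (e c a) (c - 2) = s a (c - 2)" using double_down[of a c] assms by auto
  moreover have "s (e c a) (c - 2 - 1) = s a (c - 2 - 1)" 
  proof (rule s_far[OF assms(1)])
    show "c - 2 - 1 + 2 < c \<or> c + 1 < c - 2 - 1" using assms(2) False by linarith
  qed
  ultimately show ?thesis using move_cong[of "e c a" a "c-2"] e_closed assms(1) by auto
qed

text \<open>Passing from \<open>a\<close> along colors \<open>c\<close> and \<open>c - 2\<close> leads to data visible from \<open>a\<close> through colors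
  below \<open>c\<close>: the three-color components are told apart by the signs at \<open>e (c - 2) a\<close>.\<close>

lemma six_iff:
  assumes V: "a \<in> V" "a' \<in> V" and c: "4 \<le> c" "c < i" and ag: "agree (c - 1) c a a'"
  shows "e c (e (c - 2) a) \<in> {e (c - 2) a, e (c - 1) (e (c - 2) a)} \<longleftrightarrow>
    e c (e (c - 2) a') \<in> {e (c - 2) a', e (c - 1) (e (c - 2) a')}"
proof -
  have ag2: "agree (c - 1) c (e (c - 2) a) (e (c - 2) a')"
  proof -
    have "[c - 2] \<in> lists {2..c - 1}" using c(1) by (simp; linarith)
    then show ?thesis using agree_walk[OF ag] by fastforce
  qed
  have xV: "e (c - 2) a \<in> V" "e (c - 2) a' \<in> V" using V e_closed by auto
  show ?thesis
    using agree_move[OF xV ag2 order_refl] agree_double[OF xV c(2) ag2]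
      agree_double[OF xV(2,1) c(2) agree_sym[OF ag2]] by blast
qed

text \<open>The sign is explicit in each case: if \<open>c - 2\<close> fixes \<open>a\<close>, it is
  minus the entry of \<open>a\<close>; on a five-vertex component it is the entry of
  \<open>e (c - 2) a\<close>; on a six-vertex component it is minus that entry, as \<open>c\<close>
  and \<open>c - 2\<close> commute at \<open>a\<close>. By \<open>six_iff\<close> the same case
  occurs at \<open>a'\<close>.\<close>

lemma agree_sig_after:
  assumes V: "a \<in> V" "a' \<in> V" and c: "4 \<le> c" "c < i" and ag: "agree (c - 1) c a a'"
    and mv: "e c a \<noteq> a" and nd: "e c a \<noteq> e (c - 1) a" "e c a' \<noteq> e (c - 1) a'"
  shows "s (e (c - 2) (e c a)) (c - 1) = s (e (c - 2) (e c a')) (c - 1)"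
proof -
  have mv': "e c a' \<noteq> a'" using agree_move[OF V ag, of c] mv by auto
  have cn: "c < n" using c i_less by auto
  show ?thesis
  proof (cases "e (c - 2) a = a")
    case True
    then have "e (c - 2) a' = a'" using agree_move[OF V ag, of "c-2"] by auto
    then have "e (c - 2) (e c a) = e c a" "e (c - 2) (e c a') = e c a'"
      using True flat_move[OF V(1) _ c(2) nd(1)] flat_move[OF V(2) _ c(2) nd(2)] c by auto
    then show ?thesis using s_flip[OF V(1) mv] s_flip[OF V(2) mv'] agreeD0[OF ag, of "c-1"] c by auto
  next
    case False
    then have F': "e (c - 2) a' \<noteq> a'" using agree_move[OF V ag, of "c-2"] by auto
    have eq: "s (e (c - 2) a) (c - 1) = s (e (c - 2) a') (c - 1)"
    proof -
      have "[c - 2] \<in> lists {2..c - 1}" using c(1) by (simp; linarith)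
      then show ?thesis using agreeD[OF ag, of "[c-2]" "c-1"] c by simp
    qed
    note T = three_colors[OF V(1) c False mv nd(1)] and T' = three_colors[OF V(2) c F' mv' nd(2)]
    show ?thesis
    proof (cases "e c (e (c - 2) a) \<in> {e (c - 2) a, e (c - 1) (e (c - 2) a)}")
      case True
      then show ?thesis using T T' six_iff[OF V c ag] eq by metis
    next
      case six: False
      then have six': "e c (e (c - 2) a') \<notin> {e (c - 2) a', e (c - 1) (e (c - 2) a')}" using six_iff[OF V c ag] by auto
      have "e (c - 2) (e c a) = e c (e (c - 2) a)" "e (c - 2) (e c a') = e c (e (c - 2) a')"
        using T T' six six' by auto
      moreover have "s (e c (e (c - 2) a)) (c - 1) = - s (e (c - 2) a) (c - 1)"
        "s (e c (e (c - 2) a')) (c - 1) = - s (e (c - 2) a') (c - 1)"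
        using s_flip[of "e (c-2) a" c] s_flip[of "e (c-2) a'" c] six six' V e_closed by auto
      ultimately show ?thesis using eq by simp
    qed
  qed
qed

text \<open>The heart of the induction. Away from double edges, agreement of
  \<open>d = e c v\<close> and \<open>d' = e c v'\<close> grows in stages, with bounds on colors and
  entries \<open>(c - 3, c - 2)\<close>, \<open>(c - 2, c - 2)\<close>,
  \<open>(c - 2, c - 1)\<close>, \<open>(c - 1, c - 1)\<close> and \<open>(c - 1, c)\<close>:
  extendability in smaller colors raises the color, and a direct computation adds each further
  entry.\<close>

lemma agree_step:
  assumes c: "2 \<le> c" "c + 2 < i" and IH: "\<And>c'. c' < c \<Longrightarrow> extendable c' \<and> rigid c'"
    and V: "v \<in> V" "v' \<in> V" and ag: "agree (c - 1) c v v'"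
  shows "agree (c - 1) c (e c v) (e c v')"
proof (cases "e c v = v")
  case True
  then show ?thesis using agree_move[OF V ag, of c] ag by auto
next
  case mv: False
  then have mv': "e c v' \<noteq> v'" using agree_move[OF V ag, of c] by auto
  define d d' where "d = e c v" and "d' = e c v'"
  have dV: "d \<in> V" "d' \<in> V" using V e_closed by (auto simp: d_def d'_def)
  have cn: "c < n" "c < i" using c i_less by auto
  have commute: "walk bs (e c x) = e c (walk bs x)" if "bs \<in> lists {2..c - 3}" for bs x
    by (rule walk_commute[symmetric]) (use that in \<open>auto simp: far_def in_lists_conv_set\<close>)
  have low: "bs \<in> lists {2..c - 1}" if "bs \<in> lists {2..c - 3}" for bs
    using that by (auto simp: in_lists_conv_set)
  have low2: "bs \<in> lists {2..c - 2}" if "bs \<in> lists {2..c - 3}" for bs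
    using that by (auto simp: in_lists_conv_set)
  have low1: "bs \<in> lists {2..c - 1}" if "bs \<in> lists {2..c - 2}" for bs
    using that by (auto simp: in_lists_conv_set)
  have agw: "agree (c - 1) c (walk bs v) (walk bs v')" if "bs \<in> lists {2..c - 1}" for bs
    using agree_walk[OF ag that] .
  have mvw: "e c (walk bs v) \<noteq> walk bs v" "e c (walk bs v') \<noteq> walk bs v'" if "bs \<in> lists {2..c - 3}" for bs
  proof -
    have "e c (walk bs x) \<noteq> walk bs x" if "e c x \<noteq> x" for x
      using that commute[OF \<open>bs \<in> _\<close>, of x] by (metis walk_rev)
    then show "e c (walk bs v) \<noteq> walk bs v" "e c (walk bs v') \<noteq> walk bs v'" using mv mv' by auto
  qed
  have dbl_iff: "e c (walk bs v) = e (c - 1) (walk bs v) \<longleftrightarrow> e c (walk bs v') = e (c - 1) (walk bs v')"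
    if bs: "bs \<in> lists {2..c - 3}" for bs
    using agree_double[OF _ _ cn(2) agw[OF low[OF bs]]] agree_double[OF _ _ cn(2) agree_sym[OF agw[OF low[OF bs]]]]
      mvw[OF bs] V by auto
  show ?thesis
  proof (cases "\<exists>bs \<in> lists {2..c - 3}. e c (walk bs v) = e (c - 1) (walk bs v)")
    case True
    then obtain bs where bs: "bs \<in> lists {2..c - 3}" "e c (walk bs v) = e (c - 1) (walk bs v)" by auto
    have b': "e c (walk bs v') = e (c - 1) (walk bs v')" using bs dbl_iff by auto
    have "2 \<le> c - 1" using bs mvw(1)[OF bs(1)] move_imp[of "c-1" "walk bs v"] by auto
    then have w: "rev bs @ (c - 1) # bs \<in> lists {2..c - 1}" using low[OF bs(1)] by auto
    \<comment> \<open>As \<open>bs\<close> commutes with color \<open>c\<close>, a double edge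
      reached after \<open>bs\<close> expresses \<open>e c\<close> at \<open>x\<close> by a word in
      smaller colors.\<close>
    have "walk (rev bs @ (c - 1) # bs) x = e c x" if "e c (walk bs x) = e (c - 1) (walk bs x)" for x
    proof -
      have "walk (rev bs @ (c - 1) # bs) x = walk (rev bs) (walk bs (e c x))"
        using that commute[OF bs(1), of x] by simp
      then show ?thesis by (simp only: walk_rev)
    qed
    then have "e c v = walk (rev bs @ (c - 1) # bs) v" "e c v' = walk (rev bs @ (c - 1) # bs) v'"
      using bs(2) b' by auto
    then show ?thesis using agree_walk[OF ag w] by simp
  next
    case False
    then have nd: "e c (walk bs v) \<noteq> e (c - 1) (walk bs v)" "e c (walk bs v') \<noteq> e (c - 1) (walk bs v')"
      if "bs \<in> lists {2..c - 3}" for bs using that dbl_iff by auto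
    have "agree (c - 3) (c - 2) d d'"
      using nondouble_agree[OF V(1) c(1) cn(2) nd(1)] nondouble_agree[OF V(2) c(1) cn(2) nd(2)]
        agree_mono[OF ag, of "c-3" "c-2"] unfolding d_def d'_def
      by (meson agree_sym agree_trans diff_le_mono2 diff_le_self one_le_numeral)
    then have ag2: "agree (c - 2) (c - 2) d d'"
      using IH[of "c-2"] dV c unfolding extendable_def by (simp add: diff_diff_add numeral_eq_Suc)
    have rigid2: "rigid (c - 2)" and rigid1: "rigid (c - 1)" using IH c by auto
    \<comment> \<open>Up to its endpoint the word has at most one letter \<open>c - 2\<close>. The
      other letters commute with color \<open>c\<close> and do not touch entry \<open>c - 1\<close>,
      so only the passage along \<open>c\<close> and then \<open>c - 2\<close> matters.\<close>
    have sig1: "s (walk ws d) (c - 1) = s (walk ws d') (c - 1)" if ws: "ws \<in> lists {2..c - 2}" for ws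
    proof -
      have "c - 2 + 2 < i" using c by auto
      from dV(1) this ws show ?thesis
      proof (cases rule: reach_cases)
        case (1 as)
        have as: "as \<in> lists {2..c - 3}" using 1(1) by (simp add: numeral_eq_Suc)
        have "walk ws d' = walk as d'"
          using walk_eq_transfer[OF rigid2 dV ag2 ws low2[OF as] 1(2)] .
        moreover have "s (walk as x) (c - 1) = s x (c - 1)" if "x \<in> V" for x
        proof (rule s_walk_far[OF that])
          fix j assume "j \<in> set as"
          then have "2 \<le> j" "j \<le> c - 3" using as by (auto simp: in_lists_conv_set)
          then show "c - 1 + 2 < j \<or> j + 1 < c - 1" by linarith
        qed
        ultimately show ?thesis using 1(2) dV
            s_flip[OF V(1) mv] s_flip[OF V(2) mv'] agreeD0[OF ag, of "c-1"] c
          by (simp add: d_def d'_def)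
      next
        case (2 as bs)
        have as: "as \<in> lists {2..c - 3}" and bs: "bs \<in> lists {2..c - 3}" using 2 by (simp_all add: numeral_eq_Suc)
        have c4: "4 \<le> c" using 2(1) by auto
        have l: "as @ (c - 2) # bs \<in> lists {2..c - 2}" using low2[OF as] low2[OF bs] c4 by auto
        have "walk ws d' = walk (as @ (c - 2) # bs) d'"
          using walk_eq_transfer[OF rigid2 dV ag2 ws l] 2(4) by simp
        then have "walk ws d' = walk as (e (c - 2) (e c (walk bs v')))" "walk ws d = walk as (e (c - 2) (e c (walk bs v)))"
          using 2(4) commute[OF bs] by (simp_all add: d_def d'_def)
        moreover have "s (e (c - 2) (e c (walk bs v))) (c - 1) = s (e (c - 2) (e c (walk bs v'))) (c - 1)"
          using agree_sig_after[OF _ _ c4 cn(2) agw[OF low[OF bs]] mvw(1)[OF bs] nd(1)[OF bs] nd(2)[OF bs]] V by auto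
        moreover have "s (walk as x) (c - 1) = s x (c - 1)" if "x \<in> V" for x
        proof (rule s_walk_far[OF that])
          fix j assume "j \<in> set as"
          then have "2 \<le> j" "j \<le> c - 3" using as by (auto simp: in_lists_conv_set)
          then show "c - 1 + 2 < j \<or> j + 1 < c - 1" by linarith
        qed
        ultimately show ?thesis using V by (simp add: e_closed)
      qed
    qed
    have "agree (c - 2) (c - 1) d d'"
      unfolding agree_def
    proof (intro ballI)
      fix ws k assume ws: "ws \<in> lists {2..c - 2}" and k: "k \<in> {1..c - 1}"
      show "s (walk ws d) k = s (walk ws d') k"
        using sig1[OF ws] agreeD[OF ag2 ws, of k] k by (cases "k = c - 1") auto
    qed
    then have ag1: "agree (c - 1) (c - 1) d d'"
      using IH[of "c-1"] dV c unfolding extendable_def by (simp add: diff_diff_add numeral_eq_Suc)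
    have sigd: "s d c = s d' c"
      using s_flip[OF V(1) mv] s_flip[OF V(2) mv'] agreeD0[OF ag, of c] c by (auto simp: d_def d'_def)
    have far_c: "s (walk ws x) c = s x c" if "ws \<in> lists {2..c - 2}" "x \<in> V" for ws x
      using s_walk_far[OF that(2), of ws c] that by (fastforce simp: in_lists_conv_set)
    \<comment> \<open>Entry \<open>c\<close> after the letter \<open>c - 1\<close> is decided by
      doubling, hence by entry \<open>c - 2\<close> after the letter \<open>c\<close>. The latter is
      accessible: the new letter \<open>c\<close> cancels the one in \<open>d = e c v\<close>, or
      acts as \<open>c - 1\<close>, or not at all.\<close>
    have down: "s (e c (walk ws d)) (c - 2) = s (e c (walk ws d')) (c - 2)"
      if ws: "ws \<in> lists {2..c - 2}" and c3: "3 \<le> c" for ws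
    proof -
      have "c - 2 + 2 < i" using c by auto
      from dV(1) this ws show ?thesis
      proof (cases rule: reach_cases)
        case (1 as)
        have as: "as \<in> lists {2..c - 3}" using 1(1) by (simp add: numeral_eq_Suc)
        have "walk ws d' = walk as d'"
          using walk_eq_transfer[OF rigid2 dV ag2 ws low2[OF as] 1(2)] .
        then have "e c (walk ws d) = walk as v" "e c (walk ws d') = walk as v'"
          using 1(2) commute[OF as] by (simp_all add: d_def d'_def)
        then show ?thesis using agreeD[OF ag low[OF as], of "c-2"] c3 by auto
      next
        case (2 as bs)
        have as: "as \<in> lists {2..c - 3}" and bs: "bs \<in> lists {2..c - 3}" using 2 by (simp_all add: numeral_eq_Suc)
        have c4: "4 \<le> c" using 2(1) by auto
        have l: "as @ (c - 2) # bs \<in> lists {2..c - 2}" using low2[OF as] low2[OF bs] c4 by auto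
        define a a' where "a = walk bs v" and "a' = walk bs v'"
        have aV: "a \<in> V" "a' \<in> V" using V by (auto simp: a_def a'_def)
        have aga: "agree (c - 1) c a a'" using agw[OF low[OF bs]] by (simp add: a_def a'_def)
        have mva: "e c a \<noteq> a" "e c a' \<noteq> a'" using mvw[OF bs] by (auto simp: a_def a'_def)
        have nda: "e c a \<noteq> e (c - 1) a" "e c a' \<noteq> e (c - 1) a'" using nd[OF bs] by (auto simp: a_def a'_def)
        define b b' where "b = e (c - 2) (e c a)" and "b' = e (c - 2) (e c a')"
        have "walk ws d' = walk (as @ (c - 2) # bs) d'"
          using walk_eq_transfer[OF rigid2 dV ag2 ws l] 2(4) by simp
        then have wb: "walk ws d = walk as b" "walk ws d' = walk as b'"
          using 2(4) commute[OF bs] by (simp_all add: d_def d'_def a_def a'_def b_def b'_def)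
        then have ecb: "e c (walk ws d) = walk as (e c b)" "e c (walk ws d') = walk as (e c b')"
          using commute[OF as] by simp_all
        show ?thesis
        proof (cases "e (c - 2) a = a")
          case True
          then have "e (c - 2) a' = a'" using agree_move[OF aV aga, of "c-2"] by auto
          then have "b = e c a" "b' = e c a'"
            using True flat_move[OF aV(1) _ cn(2) nda(1)] flat_move[OF aV(2) _ cn(2) nda(2)] c4
            by (auto simp: b_def b'_def)
          then show ?thesis using ecb agreeD[OF aga low[OF as], of "c-2"] c4 by auto
        next
          case mv2: False
          then have mv2': "e (c - 2) a' \<noteq> a'" using agree_move[OF aV aga, of "c-2"] by auto
          note T = three_colors[OF aV(1) c4 cn(2) mv2 mva(1) nda(1)]
            and T' = three_colors[OF aV(2) c4 cn(2) mv2' mva(2) nda(2)]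
          show ?thesis
          proof (cases "e c (e (c - 2) a) \<in> {e (c - 2) a, e (c - 1) (e (c - 2) a)}")
            case False
            then have "e c (e (c - 2) a') \<notin> {e (c - 2) a', e (c - 1) (e (c - 2) a')}"
              using six_iff[OF aV c4 cn(2) aga] by auto
            then have "e c b = e (c - 2) a" "e c b' = e (c - 2) a'"
              using T T' False unfolding b_def b'_def by (metis e_inv)+
            moreover have "as @ [c - 2] \<in> lists {2..c - 1}" using low[OF as] c4 by auto
            ultimately show ?thesis using ecb agreeD[OF aga, of "as @ [c - 2]" "c-2"] c4 by auto
          next
            case True
            then have "e c (e (c - 2) a') \<in> {e (c - 2) a', e (c - 1) (e (c - 2) a')}"
              using six_iff[OF aV c4 cn(2) aga] by auto
            \<comment> \<open>On a five-vertex component color \<open>c\<close> at \<open>b\<close>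
              is idle or doubles color \<open>c - 1\<close>; words in colors below \<open>c\<close>
              from \<open>d\<close> and \<open>d'\<close> are already compared by
              \<open>ag1\<close>.\<close>
            then have cb: "e c b \<in> {b, e (c - 1) b}" "e c b' \<in> {b', e (c - 1) b'}"
              using T T' True unfolding b_def b'_def by metis+
            have bV: "b \<in> V" "b' \<in> V" using aV e_closed by (auto simp: b_def b'_def)
            have l2: "(c - 2) # bs \<in> lists {2..c - 1}" using low[OF bs] c4 by auto
            have agb: "agree (c - 1) (c - 1) b b'"
              using agree_walk[OF ag1 l2] commute[OF bs]
              by (simp add: b_def b'_def a_def a'_def d_def d'_def)
            have "s b c = s b' c"
            proof -
              have "s (walk ((c - 2) # bs) d) c = s (walk ((c - 2) # bs) d') c"
                using far_c[of "(c-2) # bs" d] far_c[of "(c-2) # bs" d'] low2[OF bs] c4 dV sigd by auto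
              then show ?thesis using commute[OF bs] by (simp add: b_def b'_def a_def a'_def d_def d'_def)
            qed
            then have mb: "e c b = b \<longleftrightarrow> e c b' = b'"
              using move_cong[OF bV, of c] agreeD0[OF agb, of "c-1"] c by auto
            show ?thesis
            proof (cases "e c b = b")
              case True
              then show ?thesis using mb ecb agreeD[OF agb low[OF as], of "c-2"] c4 by auto
            next
              case False
              then have "e c b = e (c - 1) b" "e c b' = e (c - 1) b'" using mb cb by auto
              moreover have "as @ [c - 1] \<in> lists {2..c - 1}" using low[OF as] c4 by auto
              ultimately show ?thesis using ecb agreeD[OF agb, of "as @ [c - 1]" "c-2"] c4 by auto
            qed
          qed
        qed
      qed
    qed
    \<comment> \<open>A change of entry \<open>c\<close> along \<open>c - 1\<close> means a double
      edge, which in turn means a change of entry \<open>c - 2\<close> along \<open>c\<close>; the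
      latter is shared by \<open>y\<close> and \<open>y'\<close>.\<close>
    have dbl: "e c y' = e (c - 1) y'"
      if "y \<in> V" "y' \<in> V" "3 \<le> c" "s (e c y) (c - 2) = s (e c y') (c - 2)" "s y (c - 2) = s y' (c - 2)"
        "s (e (c - 1) y) c \<noteq> s y c" for y y'
    proof -
      have "e c y = e (c - 1) y" using double_up[of y c] that cn by auto
      moreover have "e (c - 1) y \<noteq> y" using that(6) by auto
      ultimately have "s (e c y) (c - 2) \<noteq> s y (c - 2)" using double_flip(2)[of y c] that by auto
      then show ?thesis using double_down[of y' c] that cn by auto
    qed
    have up: "s (e (c - 1) (walk ws d)) c = s (e (c - 1) (walk ws d')) c"
      if ws: "ws \<in> lists {2..c - 2}" and c3: "3 \<le> c" for ws
    proof -
      let ?y = "walk ws d" and ?y' = "walk ws d'"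
      have yV: "?y \<in> V" "?y' \<in> V" using dV by auto
      have e2: "s (e c ?y) (c - 2) = s (e c ?y') (c - 2)" using down[OF ws c3] .
      have e1: "s ?y (c - 2) = s ?y' (c - 2)" using agreeD[OF ag1 low1[OF ws], of "c-2"] c3 by auto
      have e0: "s ?y c = s ?y' c" using far_c[OF ws] dV sigd by simp
      have sg: "s z c = 1 \<or> s z c = -1" if "z \<in> V" for z using s_sign[OF that, of c] c cn by auto
      have mvy: "e (c - 1) ?y = ?y \<longleftrightarrow> e (c - 1) ?y' = ?y'"
        using agree_move[OF _ _ agree_walk[OF ag1 low1[OF ws]], of "c-1"] dV by auto
      have X: "s (e (c - 1) ?y) c \<noteq> s ?y c \<longleftrightarrow> s (e (c - 1) ?y') c \<noteq> s ?y' c"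
      proof
        assume h: "s (e (c - 1) ?y) c \<noteq> s ?y c"
        then have "e (c - 1) ?y \<noteq> ?y" by auto
        then show "s (e (c - 1) ?y') c \<noteq> s ?y' c"
          using dbl[OF yV c3 e2 e1 h] double_flip(1)[OF yV(2), of c] mvy by auto
      next
        assume h: "s (e (c - 1) ?y') c \<noteq> s ?y' c"
        then have "e (c - 1) ?y' \<noteq> ?y'" by auto
        then show "s (e (c - 1) ?y) c \<noteq> s ?y c"
          using dbl[OF yV(2,1) c3 e2[symmetric] e1[symmetric] h] double_flip(1)[OF yV(1), of c] mvy by auto
      qed
      then show ?thesis using e0 sg[OF yV(1)] sg[OF yV(2)] sg[OF e_closed[OF yV(1)], of "c-1"]
          sg[OF e_closed[OF yV(2)], of "c-1"] by metis
    qed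
    \<comment> \<open>Letters up to \<open>c - 2\<close> leave entry \<open>c\<close> alone, so
      after reduction to at most one letter \<open>c - 1\<close> only \<open>up\<close>
      remains.\<close>
    have sig0: "s (walk ws d) c = s (walk ws d') c" if ws: "ws \<in> lists {2..c - 1}" for ws
    proof -
      have "c - 1 + 2 < i" using c by auto
      from dV(1) this ws show ?thesis
      proof (cases rule: reach_cases)
        case (1 as)
        have as: "as \<in> lists {2..c - 2}" using 1(1) by (simp add: numeral_eq_Suc)
        have "walk ws d' = walk as d'"
          using walk_eq_transfer[OF rigid1 dV ag1 ws low1[OF as] 1(2)] .
        then show ?thesis using 1(2) far_c[OF as] dV sigd by simp
      next
        case (2 as bs)
        have as: "as \<in> lists {2..c - 2}" and bs: "bs \<in> lists {2..c - 2}" using 2 by (simp_all add: numeral_eq_Suc)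
        have c3: "3 \<le> c" using 2(1) by auto
        have l: "as @ (c - 1) # bs \<in> lists {2..c - 1}" using low1[OF as] low1[OF bs] c3 by auto
        have "walk ws d' = walk (as @ (c - 1) # bs) d'"
          using walk_eq_transfer[OF rigid1 dV ag1 ws l] 2(4) by simp
        then show ?thesis using 2(4) far_c[OF as] up[OF bs c3] dV by (simp add: e_closed)
      qed
    qed
    show ?thesis
      unfolding agree_def d_def[symmetric] d'_def[symmetric]
    proof (intro ballI)
      fix ws k assume ws: "ws \<in> lists {2..c - 1}" and k: "k \<in> {1..c}"
      show "s (walk ws d) k = s (walk ws d') k"
        using sig0[OF ws] agreeD[OF ag1 ws, of k] k by (cases "k = c") auto
    qed
  qed
qed

section \<open>The simultaneous induction on the color\<close>

lemma extendable_step: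
  assumes c: "c + 2 < i" and IH: "\<And>c'. c' < c \<Longrightarrow> extendable c' \<and> rigid c'"
  shows "extendable c"
  unfolding extendable_def
proof (intro ballI impI)
  fix v v' assume V: "v \<in> V" "v' \<in> V" and ag: "agree (c - 1) c v v'"
  have step: "agree (c - 1) c (walk ws v) (walk ws v')" if "ws \<in> lists {2..c}" for ws
    using that
  proof (induction ws)
    case (Cons j ws)
    then show ?case
      using agree_step[OF _ c IH, of "walk ws v" "walk ws v'"] agree_walk[of "c-1" c "walk ws v" "walk ws v'" "[j]"] V
      by (cases "j = c") auto
  qed (use ag in auto)
  show "agree c c v v'"
    unfolding agree_def using agreeD0[OF step] by auto
qed

text \<open>With a single letter \<open>c\<close>, the claim is that a given word in lower colors
  leads from \<open>e c a\<close> back to \<open>a\<close>. If \<open>e c a\<close> lies in the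
  lower component of \<open>a\<close>, lower rigidity applies. Otherwise the word would close up at
  \<open>e c a\<close>, which would then share entry \<open>c - 1\<close> with \<open>a\<close>,
  although color \<open>c\<close> flips it.\<close>

lemma rigid_step:
  assumes c: "c + 2 < i" and IH: "\<And>c'. c' < c \<Longrightarrow> extendable c' \<and> rigid c'"
  shows "rigid c"
  unfolding rigid_def
proof (intro ballI impI)
  fix v ws assume v: "v \<in> V" and ws: "ws \<in> lists {2..c}" and ag: "agree (c - 1) (c - 1) v (walk ws v)"
  have same: "walk us x = x"
    if "x \<in> V" "us \<in> lists {2..c - 1}" "2 \<le> c" "agree (c - 1) (c - 1) x (walk us x)" for x us
    using IH[of "c-1"] that agree_mono[OF that(4), of "c-1-1" "c-1-1"] unfolding rigid_def by auto
  from v c ws show "walk ws v = v"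
  proof (cases rule: reach_cases)
    case (1 as)
    show ?thesis
    proof (cases "2 \<le> c")
      case True then show ?thesis using same[OF v 1(1)] 1 ag by simp
    next
      case False
      then have "ws = []" using ws by (cases ws) auto
      then show ?thesis by simp
    qed
  next
    case (2 as bs)
    define a where "a = walk bs v"
    have a: "a \<in> V" using v by (simp add: a_def)
    have bV: "walk bs (walk ws v) = walk (bs @ as) (e c a)" using 2(4) by (simp add: a_def)
    have l: "bs @ as \<in> lists {2..c - 1}" using 2 by auto
    have agb: "agree (c - 1) (c - 1) a (walk (bs @ as) (e c a))"
      using agree_walk[OF ag 2(3)] bV by (simp add: a_def)
    have "walk (bs @ as) (e c a) = a"
    proof (cases "\<exists>us \<in> lists {2..c - 1}. e c a = walk us a")
      case True
      then obtain us where us: "us \<in> lists {2..c - 1}" "e c a = walk us a" by auto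
      then show ?thesis using same[OF a, of "bs @ as @ us"] 2 agb by simp
    next
      case False
      then have mv: "e c a \<noteq> a" by (metis foldr.simps(1) id_apply lists.Nil)
      have nd: "e c (walk us a) \<noteq> e (c - 1) (walk us a)" if us: "us \<in> lists {2..c - 3}" for us
      proof
        assume h: "e c (walk us a) = e (c - 1) (walk us a)"
        have com: "walk us (e c a) = e c (walk us a)"
          by (rule walk_commute[symmetric]) (use us in \<open>auto simp: far_def in_lists_conv_set\<close>)
        have "walk (rev us @ (c - 1) # us) a = walk (rev us) (walk us (e c a))"
          using com h by simp
        then have eq: "e c a = walk (rev us @ (c - 1) # us) a" by (simp only: walk_rev)
        have "e c (walk us a) \<noteq> walk us a" using com mv by (metis walk_rev)
        then have "2 \<le> c - 1" using h move_imp[of "c-1" "walk us a"] by auto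
        then have "rev us @ (c - 1) # us \<in> lists {2..c - 1}" using us by (auto simp: in_lists_conv_set)
        then show False using False eq by blast
      qed
      have "agree (c - 3) (c - 2) a (e c a)" using nondouble_agree[OF a 2(1) _ nd] c by auto
      then have ad: "agree (c - 2) (c - 2) a (e c a)"
        using IH[of "c-2"] a e_closed 2(1) unfolding extendable_def by (simp add: diff_diff_add numeral_eq_Suc)
      \<comment> \<open>Both \<open>e c a\<close> and the end of the word resemble \<open>a\<close>;
        rigidity for \<open>c - 1\<close> then closes the word at \<open>e c a\<close>.\<close>
      have "agree (c - 1 - 1) (c - 1 - 1) (e c a) (walk (bs @ as) (e c a))"
        using agree_trans[OF agree_sym[OF ad]] agree_mono[OF agb, of "c-2" "c-2"]
        by (simp add: diff_diff_add numeral_eq_Suc)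
      then have "walk (bs @ as) (e c a) = e c a"
        using IH[of "c-1"] l e_closed[OF a, of c] 2(1) unfolding rigid_def by (metis diff_less less_le_trans zero_less_one zero_less_numeral)
      then have "s a (c - 1) = s (e c a) (c - 1)" using agreeD0[OF agb, of "c-1"] 2(1) by auto
      moreover have "1 \<le> c - 1" "c - 1 < n" using 2(1) c i_less by linarith+
      ultimately show ?thesis using s_flip[OF a mv] sign_neq[OF a, of "c-1"] by simp
    qed
    then have "walk bs (walk ws v) = walk bs v" using bV by (simp add: a_def)
    then show ?thesis by (metis walk_rev)
  qed
qed

lemma extendable_rigid: "c + 2 < i \<Longrightarrow> extendable c \<and> rigid c"
proof (induction c rule: less_induct)
  case (less c)
  have "\<And>c'. c' < c \<Longrightarrow> extendable c' \<and> rigid c'" using less by auto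
  then show ?case using extendable_step rigid_step less.prems by blast
qed

section \<open>Packages and the rewired involution\<close>

definition outer :: "nat set" where
  "outer = {j. 1 < j \<and> j < n \<and> far j i}"

text \<open>The \<open>i\<close>-package, described by words so that a map can be defined by letting
  the same words act on a second base point.\<close>

definition orbit :: "'v \<Rightarrow> 'v set" where
  "orbit v = (\<lambda>ws. walk ws v) ` lists outer"

text \<open>The set \<open>W\<close> in terms of the involutions: an inner vertex of a non-flat
  chain is already an inner vertex of a chain of four, see \<open>W_matching\<close>.\<close>

definition switching :: "'v set" where
  "switching = {w \<in> V. e i w \<noteq> w \<and> e (i - 1) w \<noteq> w \<and> e i (e (i - 1) w) \<noteq> e (i - 1) w \<and> e i w \<noteq> e (i - 1) w}"

text \<open>At either end of the \<open>(i - 1)\<close>-edge the entries \<open>i - 1\<close> and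
  \<open>i\<close> are opposite; the edge flips the former, hence also the latter.\<close>

lemma switchingD:
  assumes "w \<in> switching"
  shows "w \<in> V" "3 \<le> i" "e i w \<noteq> w" "e (i - 1) w \<noteq> w" "e i w \<noteq> e (i - 1) w"
    "s (e (i - 1) w) i = - s w i" "s (e (i - 1) w) (i - 1) = - s w (i - 1)" "e (i - 1) w \<in> switching"
proof -
  let ?u = "e (i - 1) w"
  show w: "w \<in> V" and i: "e i w \<noteq> w" and u: "?u \<noteq> w" and d: "e i w \<noteq> ?u"
    using assms by (auto simp: switching_def)
  have "e i ?u \<noteq> ?u" using assms by (auto simp: switching_def)
  then show "s ?u i = - s w i" "s ?u (i - 1) = - s w (i - 1)"
    using move_iff[OF w, of i] move_iff[OF e_closed[OF w, of "i-1"], of i] move_imp[OF i] s_flip[OF w u] i by auto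
  show "3 \<le> i" using move_imp[OF u] by auto
  show "?u \<in> switching"
    using assms by (auto simp: switching_def e_closed) (metis e_inv)
qed

section \<open>Flatness and agreement across an edge inside \<open>W\<close>\<close>

lemma walk_split:
  assumes "\<And>j. j \<in> set ws \<Longrightarrow> far j k"
  shows "walk ws v = walk (filter (\<lambda>j. k < j) ws) (walk (filter (\<lambda>j. j < k) ws) v)"
  using assms
proof (induction ws)
  case (Cons j ws)
  then have IH: "walk ws v = walk (filter (\<lambda>j. k < j) ws) (walk (filter (\<lambda>j. j < k) ws) v)" by simp
  have j: "far j k" using Cons by simp
  show ?case
  proof (cases "k < j")
    case True
    then show ?thesis using IH by simp
  next
    case False
    then have jk: "j < k" using j by (auto simp: far_def)
    \<comment> \<open>Colors on different sides of \<open>k\<close>, both far from \<open>k\<close>,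
      differ by at least 6.\<close>
    have "e j (walk (filter (\<lambda>j. k < j) ws) x) = walk (filter (\<lambda>j. k < j) ws) (e j x)" for x
    proof (rule walk_commute)
      fix l assume "l \<in> set (filter (\<lambda>j. k < j) ws)"
      then have "far l k" "k < l" using Cons.prems by auto
      then show "far l j" using jk by (auto simp: far_def)
    qed
    then show ?thesis using IH jk False by simp
  qed
qed simp

lemma s_low_walk:
  assumes "w \<in> V" "bs \<in> lists {2..c}" "c + 2 \<le> h"
  shows "s (walk bs w) h = s w h"
proof (rule s_walk_far[OF assms(1)])
  fix j assume "j \<in> set bs"
  then have "j \<le> c" using assms(2) by (auto simp: in_lists_conv_set)
  then show "h + 2 < j \<or> j + 1 < h" using assms(3) by linarith
qed

text \<open>The edge changes entry \<open>i\<close>, which color \<open>i - 2\<close> cannot do. So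
  it is not doubled by color \<open>i - 2\<close>, and entry \<open>i - 3\<close> is
  preserved.\<close>

lemma switching_flat:
  assumes w: "w \<in> switching" and i: "4 \<le> i" and bs: "\<forall>j \<in> set bs. 1 < j \<and> far j (i - 1)"
  shows "s (e (i - 1) (walk bs w)) (i - 3) = s (walk bs w) (i - 3)"
proof -
  note wD = switchingD[OF w]
  define as where "as = filter (\<lambda>j. j < i - 1) bs"
  define cs where "cs = filter (\<lambda>j. i - 1 < j) bs"
  have as: "\<And>j. j \<in> set as \<Longrightarrow> far j (i - 1) \<and> j + 3 \<le> i - 1"
    using bs by (fastforce simp: as_def far_def)
  have cs: "\<And>j. j \<in> set cs \<Longrightarrow> far j (i - 1) \<and> i + 2 \<le> j"
    using bs i by (fastforce simp: cs_def far_def)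
  have sp: "walk bs w = walk cs (walk as w)"
    unfolding as_def cs_def by (rule walk_split) (use bs in auto)
  \<comment> \<open>The letter \<open>i + 2\<close> may change entry \<open>i\<close>, so the sign
    argument is made before the letters above \<open>i - 1\<close> act; these commute with color
    \<open>i - 1\<close> and leave entry \<open>i - 3\<close> alone.\<close>
  let ?x = "walk as w"
  have x: "?x \<in> V" using wD(1) by simp
  have "e (i - 1) ?x = walk as (e (i - 1) w)"
    by (rule walk_commute) (use as in auto)
  moreover have "s (walk as y) i = s y i" if "y \<in> V" for y
    by (rule s_walk_far[OF that]) (use as in force)
  ultimately have fl: "s (e (i - 1) ?x) i = - s ?x i" using wD(1,6) by (simp add: e_closed)
  have ne: "s ?x i \<noteq> - s ?x i" using sign_neq[OF x, of i] i i_less by auto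
  have "s (e (i - 1) ?x) (i - 3) = s ?x (i - 3)"
  proof (rule ccontr)
    assume a: "\<not> ?thesis"
    have i3: "i - 1 - 2 = i - 3" "i - 1 - 1 = i - 2" by auto
    have "e (i - 1) ?x = e (i - 2) ?x" using double_down[OF x, of "i-1"] a i unfolding i3 by auto
    moreover have "s (e (i - 2) ?x) i = s ?x i" by (rule s_far[OF x]) (use i in linarith)
    ultimately show False using fl ne by simp
  qed
  moreover have "e (i - 1) (walk cs ?x) = walk cs (e (i - 1) ?x)"
    by (rule walk_commute) (use cs in auto)
  moreover have "s (walk cs y) (i - 3) = s y (i - 3)" if "y \<in> V" for y
  proof (rule s_walk_far[OF that])
    fix j assume "j \<in> set cs"
    then have "i + 2 \<le> j" using cs by blast
    then show "i - 3 + 2 < j \<or> j + 1 < i - 3" using i by linarith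
  qed
  ultimately show ?thesis using x by (simp add: sp e_closed)
qed

text \<open>Words up to color \<open>i - 4\<close> commute with color \<open>i - 1\<close>, which is
  too far from the entries below \<open>i - 3\<close> and preserves entry \<open>i - 3\<close> by
  flatness. Extendability then adds color \<open>i - 3\<close>.\<close>

lemma switching_agree:
  assumes w: "w \<in> switching"
  shows "agree (i - 3) (i - 3) w (e (i - 1) w)"
proof -
  note wD = switchingD[OF w]
  have "agree (i - 3 - 1) (i - 3) w (e (i - 1) w)"
    unfolding agree_def
  proof (intro ballI)
    fix ws k assume ws: "ws \<in> lists {2..i - 3 - 1}" and k: "k \<in> {1..i - 3}"
    have f: "\<forall>j \<in> set ws. 1 < j \<and> far j (i - 1)" using ws by (auto simp: in_lists_conv_set far_def)
    have com: "e (i - 1) (walk ws w) = walk ws (e (i - 1) w)" by (rule walk_commute) (use f in auto)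
    show "s (walk ws w) k = s (walk ws (e (i - 1) w)) k"
    proof (cases "k = i - 3")
      case True
      then have "4 \<le> i" using k by auto
      then show ?thesis using switching_flat[OF w _ f] com True by simp
    next
      case False
      then have "s (e (i - 1) (walk ws w)) k = s (walk ws w) k"
        by (intro s_far) (use wD(1) k in auto)
      then show ?thesis using com by simp
    qed
  qed
  then show ?thesis using extendable_rigid[of "i-3"] wD(1,2) unfolding extendable_def by (auto simp: e_closed)
qed

section \<open>The isomorphism between the two packages\<close>

lemma outer_parts:
  assumes "ws \<in> lists outer"
  obtains as bs where "as \<in> lists {2..i - 3}" "\<forall>j \<in> set bs. i + 3 \<le> j"
    "\<And>v. walk ws v = walk bs (walk as v)"
proof (rule that)
  have f: "\<And>j. j \<in> set ws \<Longrightarrow> 1 < j \<and> far j i" using assms by (auto simp: outer_def in_lists_conv_set)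
  then show "filter (\<lambda>j. j < i) ws \<in> lists {2..i - 3}" by (fastforce simp: far_def in_lists_conv_set)
  show "\<forall>j \<in> set (filter (\<lambda>j. i < j) ws). i + 3 \<le> j" using f by (fastforce simp: far_def)
  show "walk ws v = walk (filter (\<lambda>j. i < j) ws) (walk (filter (\<lambda>j. j < i) ws) v)" for v
    by (rule walk_split) (use f in auto)
qed

lemma high_commute:
  assumes "\<forall>j \<in> set bs. i + 3 \<le> j" "k \<le> i"
  shows "e k (walk bs v) = walk bs (e k v)"
  by (rule walk_commute) (use assms in \<open>force simp: far_def\<close>)

lemma high_commutes:
  assumes "\<forall>j \<in> set bs. i + 3 \<le> j" "as \<in> lists {2..i - 3}"
  shows "walk as (walk bs v) = walk bs (walk as v)"
  using assms(2)
proof (induction as)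
  case (Cons k as)
  then have "walk as (walk bs v) = walk bs (walk as v)" "k \<le> i" by auto
  then show ?case using high_commute[OF assms(1)] by simp
qed simp

lemma s_high_walk:
  assumes "v \<in> V" "\<forall>j \<in> set bs. i + 3 \<le> j" "h \<le> i"
  shows "s (walk bs v) h = s v h"
  by (rule s_walk_far[OF assms(1)]) (use assms(2,3) in force)

text \<open>The high part of the word is invisible to the comparison in low colors, so rigidity
  closes the low part at \<open>w\<close> by itself, and then the high part as well. The low part
  carries over by \<open>walk_eq_transfer\<close>, the high part because it commutes with color
  \<open>i - 1\<close>.\<close>

lemma closed_walk_transfer:
  assumes w: "w \<in> switching" and ws: "ws \<in> lists outer" and cl: "walk ws w = w"
  shows "walk ws (e (i - 1) w) = e (i - 1) w"
proof -
  note wD = switchingD[OF w]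
  let ?u = "e (i - 1) w"
  obtain as bs where as: "as \<in> lists {2..i - 3}" and bs: "\<forall>j \<in> set bs. i + 3 \<le> j"
    and sp: "\<And>v. walk ws v = walk bs (walk as v)" using outer_parts[OF ws] by metis
  have rig: "rigid (i - 3)" using extendable_rigid[of "i-3"] wD(2) by auto
  have high: "agree (i - 3) (i - 3) x (walk bs x)" if "x \<in> V" for x
    unfolding agree_def
  proof (intro ballI)
    fix us k assume "us \<in> lists {2..i - 3}" "k \<in> {1..i - 3}"
    then show "s (walk us x) k = s (walk us (walk bs x)) k"
      using high_commutes[OF bs, of us x] s_high_walk[OF _ bs, of "walk us x" k] that by auto
  qed
  have fix_w: "walk us w = w" if "us \<in> lists {2..i - 3}" "agree (i - 3) (i - 3) w (walk us w)" for us
    using rig that wD(1) agree_mono[OF that(2), of "i-3-1" "i-3-1"] unfolding rigid_def by auto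
  have "agree (i - 3) (i - 3) w (walk as w)"
    using high[of "walk as w"] wD(1) cl sp[of w] by (simp add: agree_sym)
  then have w1: "walk as w = w" using fix_w as by blast
  then have w2: "walk bs w = w" using cl sp[of w] by simp
  have "walk as ?u = ?u"
    using walk_eq_transfer[OF rig wD(1) e_closed[OF wD(1)] switching_agree[OF w] as, of "[]"] w1 by simp
  moreover have "walk bs ?u = ?u" using high_commute[OF bs, of "i-1" w] w2 by simp
  ultimately show ?thesis using sp by simp
qed

lemma walk_eq_outer:
  assumes "w \<in> switching" "ws \<in> lists outer" "us \<in> lists outer" "walk ws w = walk us w"
  shows "walk ws (e (i - 1) w) = walk us (e (i - 1) w)"
proof -
  have "walk (rev us @ ws) w = walk (rev us) (walk us w)" using assms(4) by simp
  then have "walk (rev us @ ws) w = w" by (simp only: walk_rev)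
  moreover have "rev us @ ws \<in> lists outer" using assms by auto
  ultimately have "walk (rev us @ ws) (e (i - 1) w) = e (i - 1) w" using closed_walk_transfer assms(1) by blast
  then have "walk us (walk (rev us @ ws) (e (i - 1) w)) = walk us (e (i - 1) w)" by simp
  then show ?thesis by simp
qed

lemma walk_eq_outer_iff:
  assumes "w \<in> switching" "ws \<in> lists outer" "us \<in> lists outer"
  shows "walk ws w = walk us w \<longleftrightarrow> walk ws (e (i - 1) w) = walk us (e (i - 1) w)"
  using walk_eq_outer[OF assms] walk_eq_outer[OF switchingD(8)[OF assms(1)] assms(2,3)] by auto

text \<open>The same word acts on \<open>w\<close> and on \<open>e (i - 1) w\<close>. By
  \<open>walk_eq_outer\<close> the result does not depend on the word chosen; the converse
  implication gives injectivity.\<close>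

lemma orbit_iso_exists:
  assumes w: "w \<in> switching"
  obtains f where "f \<in> extensional (orbit w)" "bij_betw f (orbit w) (orbit (e (i - 1) w))"
    "\<And>ws. ws \<in> lists outer \<Longrightarrow> f (walk ws w) = walk ws (e (i - 1) w)"
proof -
  let ?u = "e (i - 1) w"
  define f where "f = restrict (\<lambda>x. walk (SOME ws. ws \<in> lists outer \<and> walk ws w = x) ?u) (orbit w)"
  have f: "f (walk ws w) = walk ws ?u" if ws: "ws \<in> lists outer" for ws
  proof -
    let ?us = "SOME us. us \<in> lists outer \<and> walk us w = walk ws w"
    have "?us \<in> lists outer \<and> walk ?us w = walk ws w" by (rule someI) (use ws in auto)
    then have "walk ?us ?u = walk ws ?u" using walk_eq_outer[OF w] ws by blast
    moreover have "walk ws w \<in> orbit w" using ws by (auto simp: orbit_def)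
    ultimately show ?thesis by (simp add: f_def)
  qed
  have "inj_on f (orbit w)"
    unfolding inj_on_def orbit_def using f walk_eq_outer_iff[OF w] by auto
  moreover have "f ` orbit w = orbit ?u"
    unfolding orbit_def using f by (force simp: image_image)
  ultimately show ?thesis using that[of f] f by (auto simp: bij_betw_def f_def)
qed

text \<open>Entries up to \<open>i - 3\<close> are affected only by the low part of the word, where
  \<open>switching_agree\<close> applies; entries from \<open>i + 2\<close> on only by the high
  part, which commutes with color \<open>i - 1\<close>.\<close>

lemma s_outer_iso:
  assumes w: "w \<in> switching" and ws: "ws \<in> lists outer" and h: "1 \<le> h" "h + 3 \<le> i \<or> i + 2 \<le> h"
  shows "s (walk ws (e (i - 1) w)) h = s (walk ws w) h"
proof -
  note wD = switchingD[OF w]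
  let ?u = "e (i - 1) w"
  obtain as bs where as: "as \<in> lists {2..i - 3}" and bs: "\<forall>j \<in> set bs. i + 3 \<le> j"
    and sp: "\<And>v. walk ws v = walk bs (walk as v)" using outer_parts[OF ws] by metis
  show ?thesis
  proof (cases "h + 3 \<le> i")
    case True
    then have "s (walk ws x) h = s (walk as x) h" if "x \<in> V" for x
      using s_high_walk[OF _ bs, of "walk as x" h] that sp by simp
    moreover have "s (walk as w) h = s (walk as ?u) h"
      using agreeD[OF switching_agree[OF w] as, of h] h(1) True by linarith
    ultimately show ?thesis using wD(1) by (simp add: e_closed)
  next
    case False
    then have hi: "i + 2 \<le> h" using h by auto
    have "s (walk ws x) h = s (walk bs x) h" if "x \<in> V" for x
      using s_low_walk[OF _ as, of "walk bs x" h] high_commutes[OF bs as, of x] that sp hi by simp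
    moreover have "s (walk bs ?u) h = s (walk bs w) h"
    proof -
      have "i - 1 + 1 < h" using hi by linarith
      then show ?thesis using high_commute[OF bs, of "i-1" w] s_far[of "walk bs w" h "i-1"] wD(1) by simp
    qed
    ultimately show ?thesis using wD(1) by (simp add: e_closed)
  qed
qed

section \<open>Orbits under the package colors\<close>

lemma orbit_closed: "v \<in> V \<Longrightarrow> orbit v \<subseteq> V"
  by (auto simp: orbit_def)

lemma orbit_self: "v \<in> orbit v"
  unfolding orbit_def by (rule image_eqI[of _ _ "[]"]) auto

lemma orbit_trans: "x \<in> orbit v \<Longrightarrow> ws \<in> lists outer \<Longrightarrow> walk ws x \<in> orbit v"
  unfolding orbit_def by (force simp: image_iff simp flip: foldr_append intro: bexI[of _ "ws @ _"])

lemma orbit_eq: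
  assumes "x \<in> orbit v" shows "orbit x = orbit v"
proof
  show "orbit x \<subseteq> orbit v" using orbit_trans[OF assms] by (auto simp: orbit_def)
  obtain ws where ws: "ws \<in> lists outer" "x = walk ws v" using assms by (auto simp: orbit_def)
  have "v = walk (rev ws) x" using ws(2) by (simp only: walk_rev)
  moreover have "rev ws \<in> lists outer" using ws by auto
  ultimately have "v \<in> orbit x" by (auto simp: orbit_def)
  then show "orbit v \<subseteq> orbit x" using orbit_trans[of v x] by (auto simp: orbit_def)
qed

lemma e_orbit: "x \<in> orbit v \<Longrightarrow> e i x \<in> orbit (e i v)"
proof -
  assume "x \<in> orbit v"
  then obtain ws where ws: "ws \<in> lists outer" "x = walk ws v" by (auto simp: orbit_def)
  have "e i x = walk ws (e i v)"
    unfolding ws(2) by (rule walk_commute) (use ws in \<open>auto simp: outer_def in_lists_conv_set\<close>)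
  then show ?thesis using ws by (auto simp: orbit_def)
qed

lemma s_orbit:
  assumes "v \<in> V" "x \<in> orbit v" "3 \<le> i" "h = i - 1 \<or> h = i"
  shows "s x h = s v h"
proof -
  obtain ws where ws: "ws \<in> lists outer" "x = walk ws v" using assms by (auto simp: orbit_def)
  show ?thesis unfolding ws(2)
    by (rule s_walk_far[OF assms(1)]) (use ws(1) assms(3,4) in \<open>fastforce simp: outer_def far_def in_lists_conv_set\<close>)
qed

lemma orbit_moves:
  assumes "w \<in> switching" "x \<in> orbit w"
  shows "e i x \<noteq> x"
  using move_cong[of x w i] s_orbit[OF _ assms(2)] switchingD[OF assms(1)] orbit_closed assms(2) by blast

text \<open>Entry \<open>i - 1\<close> is constant on each package and differs between the
  two.\<close>

lemma orbit_disjoint: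
  assumes "w \<in> switching"
  shows "orbit w \<inter> orbit (e (i - 1) w) = {}"
proof -
  note wD = switchingD[OF assms]
  have "s w (i - 1) \<noteq> - s w (i - 1)" by (rule sign_neq) (use wD(1,2) i_less in auto)
  then show ?thesis
    using wD(7) s_orbit[OF wD(1), of _ "i-1"] s_orbit[OF e_closed[OF wD(1)], of _ "i-1" "i-1"] wD(2) by fastforce
qed

text \<open>If \<open>w\<close> were moved onto a double edge by color \<open>i - 3\<close>, then by the three-color components of
  colors \<open>i - 3\<close>, \<open>i - 2\<close>, \<open>i - 1\<close> either the doubling would already occur at \<open>w\<close>, or the edge would
  even be triple, although color \<open>i - 2\<close> cannot change the entry at \<open>i\<close>.\<close>

lemma orbit_nondouble:
  assumes w: "w \<in> switching" and x: "x \<in> orbit w"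
  shows "e i x \<noteq> e (i - 1) x"
proof
  assume dx: "e i x = e (i - 1) x"
  note wD = switchingD[OF w]
  obtain ws where ws: "ws \<in> lists outer" "x = walk ws w" using x by (auto simp: orbit_def)
  obtain as bs where as: "as \<in> lists {2..i - 3}" and bs: "\<forall>j \<in> set bs. i + 3 \<le> j"
    and sp: "\<And>v. walk ws v = walk bs (walk as v)" using outer_parts[OF ws(1)] by metis
  have low_commute: "e k (walk cs y) = walk cs (e k y)" if "cs \<in> lists {2..i - 3 - 1}" "k = i \<or> k = i - 1" for cs k y
    by (rule walk_commute) (use that in \<open>auto simp: far_def in_lists_conv_set\<close>)
  have inj: "y = z" if "walk cs y = walk cs z" for cs y z using that by (metis walk_rev)
  have "walk bs (e i (walk as w)) = walk bs (e (i - 1) (walk as w))"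
    using dx high_commute[OF bs, of i "walk as w"] high_commute[OF bs, of "i-1" "walk as w"] sp ws(2) by simp
  then have da: "e i (walk as w) = e (i - 1) (walk as w)" by (rule inj)
  have "i - 3 + 2 < i" using wD(2) by auto
  from wD(1) this as show False
  proof (cases rule: reach_cases)
    case (1 cs)
    have "walk cs (e i w) = walk cs (e (i - 1) w)"
      using da low_commute[OF 1(1), of i w] low_commute[OF 1(1), of "i-1" w] 1(2) by simp
    then show False using inj wD(5) by blast
  next
    case (2 cs ds)
    define a where "a = walk ds w"
    define b where "b = e (i - 3) a"
    have aV: "a \<in> V" "b \<in> V" using wD(1) by (auto simp: a_def b_def e_closed)
    have i5: "5 \<le> i" using 2(1) by auto
    have wb: "walk as w = walk cs b" using 2(4) by (simp add: a_def b_def)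
    have "walk cs (e i b) = walk cs (e (i - 1) b)"
      using da low_commute[OF 2(2), of i b] low_commute[OF 2(2), of "i-1" b] wb by simp
    then have db: "e i b = e (i - 1) b" by (rule inj)
    have sds: "s (walk ds y) i = s y i" if "y \<in> V" for y
      using s_low_walk[OF that 2(3), of i] i5 by simp
    have sa: "s (e (i - 1) a) i = - s a i"
      using wD(1,6) sds low_commute[OF 2(3), of "i-1" w] by (simp add: a_def e_closed)
    have ne: "s y i \<noteq> - s y i" if "y \<in> V" for y using sign_neq[OF that, of i] i5 i_less by auto
    have nda: "e i a \<noteq> e (i - 1) a"
      using inj[of ds "e i w" "e (i-1) w"] wD(5) low_commute[OF 2(3), of i w] low_commute[OF 2(3), of "i-1" w]
      by (auto simp: a_def)
    have mv: "e (i - 1) a \<noteq> a" using sa ne[OF aV(1)] by auto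
    have two: "s (e (i - 2) y) i = s y i" if "y \<in> V" for y
      by (rule s_far[OF that]) (use i5 in linarith)
    have nd: "e (i - 1) a \<noteq> e (i - 2) a" using sa ne[OF aV(1)] two[OF aV(1)] by metis
    have "e i a \<noteq> a" using wD(3) inj[of ds "e i w" w] low_commute[OF 2(3), of i w] by (auto simp: a_def)
    have com3: "e (i - 3) (e i y) = e i (e (i - 3) y)" for y by (rule e_commute) (use i5 in \<open>auto simp: far_def\<close>)
    have mb: "e i b \<noteq> b" using \<open>e i a \<noteq> a\<close> com3[of a] e_inv unfolding b_def by metis
    have bi: "s (e i b) i = - s b i" using s_flip[OF aV(2) mb] by simp
    have mv3: "e (i - 3) a \<noteq> a" using db nda by (auto simp: b_def)
    have arith: "i - 1 - 2 = i - 3" "i - 1 - 1 = i - 2" by auto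
    have "4 \<le> i - 1" "i - 1 < i" using i5 by auto
    note T = three_colors[OF aV(1) this, unfolded arith, OF mv3 mv nd, folded b_def]
    then have "e (i - 3) (e (i - 1) a) = e (i - 1) b \<or> e (i - 1) b = b \<or> e (i - 1) b = e (i - 2) b" by auto
    then show False
    proof (elim disjE)
      assume "e (i - 3) (e (i - 1) a) = e (i - 1) b"
      then have "e (i - 3) (e (i - 1) a) = e (i - 3) (e i a)" using db com3[of a] by (simp add: b_def)
      then show False using nda by (metis e_inv)
    next
      assume "e (i - 1) b = b" then show False using db mb by simp
    next
      assume "e (i - 1) b = e (i - 2) b"
      then show False using db bi two[OF aV(2)] ne[OF aV(2)] by simp
    qed
  qed
qed

section \<open>The rewired involution\<close>

context
  fixes w :: 'v and f :: "'v \<Rightarrow> 'v"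
  assumes w: "w \<in> switching"
    and bij: "bij_betw f (orbit w) (orbit (e (i - 1) w))"
    and fw: "f w = e (i - 1) w"
begin

definition swap :: "'v \<Rightarrow> 'v" where
  "swap v = (if v \<in> orbit w then f v else inv_into (orbit w) f v)"

definition dom :: "'v set" where
  "dom = orbit w \<union> orbit (e (i - 1) w)"

text \<open>Coincides with \<open>phi_map\<close> on the vertices with an \<open>i\<close>-neighbour
  and, by \<open>rewire_moves\<close>, fixes the others.\<close>

definition rewire :: "'v \<Rightarrow> 'v" where
  "rewire v = (if v \<in> dom then swap v else if e i v \<in> dom then e i (swap (e i v)) else e i v)"

lemma swap_left:
  assumes v: "v \<in> orbit w" shows "swap v \<in> orbit (e (i - 1) w) \<and> swap (swap v) = v"
proof -
  have "f v \<in> orbit (e (i - 1) w)" using bij v by (auto simp: bij_betw_def)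
  moreover have "inv_into (orbit w) f (f v) = v" using bij v by (simp add: bij_betw_def)
  ultimately show ?thesis using v orbit_disjoint[OF w] by (auto simp: swap_def)
qed

lemma swap_right:
  assumes v: "v \<in> orbit (e (i - 1) w)" shows "swap v \<in> orbit w \<and> swap (swap v) = v"
proof -
  have "v \<in> f ` orbit w" using bij v by (simp add: bij_betw_def)
  then have "inv_into (orbit w) f v \<in> orbit w" "f (inv_into (orbit w) f v) = v"
    by (auto simp: inv_into_into f_inv_into_f)
  moreover have "v \<notin> orbit w" using v orbit_disjoint[OF w] by auto
  ultimately show ?thesis by (simp add: swap_def)
qed

lemma swap: "v \<in> dom \<Longrightarrow> swap v \<in> dom \<and> swap (swap v) = v \<and> swap v \<noteq> v"
  using swap_left[of v] swap_right[of v] orbit_disjoint[OF w] unfolding dom_def by (metis Un_iff disjoint_iff)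

lemma dom_V: "dom \<subseteq> V"
  using orbit_closed switchingD(1)[OF w] e_closed unfolding dom_def by blast

lemma dom_moves: "v \<in> dom \<Longrightarrow> e i v \<noteq> v"
  using orbit_moves w switchingD(8)[OF w] unfolding dom_def by blast

lemma dom_nondouble: "v \<in> dom \<Longrightarrow> e i v \<noteq> e (i - 1) v"
  using orbit_nondouble w switchingD(8)[OF w] unfolding dom_def by blast

text \<open>The image of an orbit under \<open>e i\<close> is again an orbit, so it equals each orbit it meets.\<close>

lemma e_dom:
  assumes v: "v \<in> dom" "e i v \<in> dom"
  shows "e i (swap v) \<in> dom"
proof -
  let ?u = "e (i - 1) w"
  have meet: "e i y \<in> orbit q" if "x \<in> orbit p" "e i x \<in> orbit q" "y \<in> orbit p" for p q x y
    using e_orbit[OF that(1)] e_orbit[OF that(3)] orbit_eq[OF that(2)] orbit_eq that(2) by metis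
  have returns: "e i y \<in> orbit p" if "x \<in> orbit p" "e i x \<in> orbit q" "y \<in> orbit q" for p q x y
    using meet[of "e i x" q p y] that by simp
  have sg: "s (e i y) i \<noteq> s y i" if "y \<in> dom" for y
    using s_flip[of y i] dom_moves[OF that] sign_neq[of y i] dom_V that switchingD(2)[OF w] i_less by force
  \<comment> \<open>Entry \<open>i\<close> is constant on a package and flipped by color
    \<open>i\<close>, so an \<open>i\<close>-edge inside \<open>dom\<close> joins the two different
    packages.\<close>
  have no: False if "x \<in> orbit p" "e i x \<in> orbit p" "p = w \<or> p = ?u" for x p
  proof -
    have p: "p \<in> V" using that switchingD(1)[OF w] e_closed[of w] by blast
    have "x \<in> dom" using that unfolding dom_def by blast
    then show False
      using sg[of x] s_orbit[OF p that(1), of i] s_orbit[OF p that(2), of i] switchingD(2)[OF w] by simp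
  qed
  show ?thesis
    using v no returns swap_left[of v] swap_right[of v] unfolding dom_def by (metis Un_iff)
qed

text \<open>The delicate case is a vertex outside \<open>dom\<close> with its
  \<open>i\<close>-neighbour inside: by \<open>e_dom\<close> its new partner is also outside, so the
  same clause leads back.\<close>

lemma rewire_inv: "rewire (rewire v) = v"
proof (cases "v \<in> dom")
  case True then show ?thesis using swap[OF True] by (simp add: rewire_def)
next
  case False
  show ?thesis
  proof (cases "e i v \<in> dom")
    case True
    have "e i (swap (e i v)) \<notin> dom"
      using e_dom[of "swap (e i v)"] swap[OF True] False by auto
    then show ?thesis using swap[OF True] True False by (simp add: rewire_def)
  next
    case F: False
    then show ?thesis using False by (simp add: rewire_def)
  qed
qed

lemma rewire_moves: "rewire v = v \<longleftrightarrow> e i v = v"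
proof (cases "v \<in> dom")
  case True then show ?thesis using dom_moves swap by (simp add: rewire_def)
next
  case False
  show ?thesis
  proof (cases "e i v \<in> dom")
    case True
    then have "e i (swap (e i v)) \<noteq> v" "e i v \<noteq> v" using False swap[OF True] by (metis e_inv, metis)
    then show ?thesis using True False by (simp add: rewire_def)
  qed (simp add: rewire_def False)
qed

lemma rewire_closed: "v \<in> V \<Longrightarrow> rewire v \<in> V"
  using swap[of v] swap[of "e i v"] dom_V e_closed unfolding rewire_def by (auto simp: subset_iff)

lemma rewire_switching:
  "{x \<in> V. rewire x \<noteq> x \<and> e (i - 1) x \<noteq> x \<and> rewire (e (i - 1) x) \<noteq> e (i - 1) x \<and> rewire x \<noteq> e (i - 1) x}
    \<subset> switching" (is "?A \<subset> _")
proof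
  show "?A \<subseteq> switching"
  proof
    fix x assume x: "x \<in> ?A"
    \<comment> \<open>Both ends of an old double edge lie outside \<open>dom\<close>, so
      \<open>rewire\<close> would keep it, contrary to the last condition on
      \<open>x\<close>.\<close>
    have "e i x \<noteq> e (i - 1) x"
    proof
      assume d: "e i x = e (i - 1) x"
      have "x \<notin> dom" using dom_nondouble d by blast
      moreover have "e i x \<notin> dom"
      proof
        assume "e i x \<in> dom"
        then have "e i (e i x) \<noteq> e (i - 1) (e i x)" by (rule dom_nondouble)
        then show False unfolding d by (metis d e_inv)
      qed
      ultimately show False using x d by (simp add: rewire_def)
    qed
    then show "x \<in> switching" using x by (auto simp: switching_def rewire_moves)
  qed
  have "rewire w = e (i - 1) w" using fw orbit_self by (simp add: rewire_def swap_def dom_def)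
  then have "w \<notin> ?A" by simp
  then show "?A \<noteq> switching" using w by blast
qed

end

end

section \<open>The moves of a signed, colored graph\<close>

lemma matching_edge_iff:
  assumes "edges G j = {{v, f v} | v. f v \<noteq> v}" "\<And>v. f (f v) = v"
  shows "c \<in> edges G j \<and> v \<in> c \<longleftrightarrow> c = {v, f v} \<and> f v \<noteq> v"
  unfolding assms(1) by (auto simp: assms(2) insert_commute)

lemma matching_has_nbr:
  assumes "edges G j = {{v, f v} | v. f v \<noteq> v}" "\<And>v. f (f v) = v"
  shows "has_nbr G j v \<longleftrightarrow> f v \<noteq> v"
  unfolding has_nbr_def using matching_edge_iff[OF assms] by auto

lemma matching_edge:
  assumes "edges G j = {{v, f v} | v. f v \<noteq> v}" "\<And>v. f (f v) = v"
  shows "{v, x} \<in> edges G j \<longleftrightarrow> x \<noteq> v \<and> f v = x"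
  using matching_edge_iff[OF assms, of "{v, x}" v] by (auto simp: doubleton_eq_iff)

lemma matching_nbr:
  assumes "edges G j = {{v, f v} | v. f v \<noteq> v}" "\<And>v. f (f v) = v" "f v \<noteq> v"
  shows "nbr G j v = f v"
  unfolding nbr_def using matching_edge[OF assms(1,2)] assms(3) by auto

text \<open>An inner vertex and its \<open>g\<close>-partner are the middle of four consecutive
  chain vertices, whose distinctness excludes a double edge. Conversely four such vertices form a
  chain with \<open>h = 2\<close>.\<close>

lemma W_matching:
  assumes f: "edges G i = {{v, f v} | v. f v \<noteq> v}" "\<And>v. f (f v) = v"
    and g: "edges G (i - 1) = {{v, g v} | v. g v \<noteq> v}" "\<And>v. g (g v) = v"
    and V: "\<And>v. v \<in> verts G \<Longrightarrow> f v \<in> verts G" "\<And>v. v \<in> verts G \<Longrightarrow> g v \<in> verts G"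
  shows "W G i = {w \<in> verts G. f w \<noteq> w \<and> g w \<noteq> w \<and> f (g w) \<noteq> g w \<and> f w \<noteq> g w}"
    (is "_ = ?R")
proof
  note nf = matching_has_nbr[OF f] matching_nbr[OF f]
    and ng = matching_has_nbr[OF g] matching_nbr[OF g]
  show "W G i \<subseteq> ?R"
  proof
    fix w assume "w \<in> W G i"
    then obtain h c j where c: "nonflat_chain G i h c" and j: "1 < j" "j < 2 * h" "w = c j"
      by (auto simp: W_def)
    \<comment> \<open>The \<open>(i - 1)\<close>-edge at \<open>c j\<close> joins the positions
      \<open>2 * k\<close> and \<open>2 * k + 1\<close>.\<close>
    define k where "k = j div 2"
    have k: "1 \<le> k" "k < h" "j = 2 * k \<or> j = 2 * k + 1" using j by (auto simp: k_def)
    have c1: "f (c (2 * l)) \<noteq> c (2 * l) \<and> c (2 * l - 1) = f (c (2 * l))" if "1 \<le> l" "l \<le> h" for l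
      using c that nf[of "c (2 * l)"] by (auto simp: nonflat_chain_def)
    have c2: "g (c (2 * k)) \<noteq> c (2 * k) \<and> c (2 * k + 1) = g (c (2 * k))"
      using c k ng[of "c (2 * k)"] by (auto simp: nonflat_chain_def)
    have "2 * k - 1 \<in> {1..2 * h}" "2 * k \<in> {1..2 * h}" "2 * k + 1 \<in> {1..2 * h}" "2 * k + 2 \<in> {1..2 * h}"
      using k by auto
    moreover have "inj_on c {1..2 * h}" "c ` {1..2 * h} \<subseteq> verts G" using c by (auto simp: nonflat_chain_def)
    ultimately have vs: "c (2 * k) \<in> verts G" "c (2 * k + 1) \<in> verts G"
      and ne: "c (2 * k - 1) \<noteq> c (2 * k + 1)" "c (2 * k + 2) \<noteq> c (2 * k)"
      by (auto dest: inj_onD)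
    have A: "f (c (2 * k)) \<noteq> c (2 * k)" "c (2 * k - 1) = f (c (2 * k))" using c1[of k] k by auto
    have "f (c (2 * k + 2)) \<noteq> c (2 * k + 2)" "c (2 * k + 1) = f (c (2 * k + 2))"
      using c1[of "k + 1"] k by auto
    then have B: "f (c (2 * k + 1)) = c (2 * k + 2)" "c (2 * k + 2) \<noteq> c (2 * k + 1)" using f(2) by metis+
    have C: "g (c (2 * k)) = c (2 * k + 1)" "g (c (2 * k + 1)) = c (2 * k)" "c (2 * k + 1) \<noteq> c (2 * k)"
      using c2 g(2) by metis+
    show "w \<in> ?R"
    proof (cases "j = 2 * k")
      case True
      then show ?thesis using vs A B C ne j(3) by simp
    next
      case False
      then have "j = 2 * k + 1" using k by simp
      then show ?thesis using vs A B C ne j(3) by auto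
    qed
  qed
  show "?R \<subseteq> W G i"
  proof
    fix w assume w: "w \<in> ?R"
    define c where "c = (\<lambda>j :: nat. if j = 1 then f w else if j = 2 then w else if j = 3 then g w else f (g w))"
    have set4: "{1..2 * 2 :: nat} = {1, 2, 3, 4}" by auto
    have cv: "c 1 = f w" "c 2 = w" "c 3 = g w" "c 4 = f (g w)" by (auto simp: c_def)
    have d: "f w \<noteq> w" "g w \<noteq> w" "f (g w) \<noteq> g w" "f w \<noteq> g w" and wV: "w \<in> verts G" using w by auto
    have d2: "f (g w) \<noteq> w" "f (g w) \<noteq> f w" using d f(2) by metis+
    have "c ` {1..2 * 2} \<subseteq> verts G" unfolding set4 using cv V wV by simp
    moreover have "inj_on c {1..2 * 2}" unfolding set4 using cv d d2 by (auto simp: inj_on_def)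
    moreover have "has_nbr G i (c (2 * j)) \<and> c (2 * j - 1) = nbr G i (c (2 * j))" if "1 \<le> j" "j \<le> 2" for j
    proof -
      have "j = 1 \<or> j = 2" using that by auto
      then show ?thesis
      proof
        assume "j = 1" then show ?thesis using nf[of w] d cv by simp
      next
        assume "j = 2"
        then show ?thesis using nf[of "f (g w)"] f(2)[of "g w"] d cv by simp
      qed
    qed
    moreover have "has_nbr G (i - 1) (c (2 * j)) \<and> c (2 * j + 1) = nbr G (i - 1) (c (2 * j))" if "1 \<le> j" "j < 2" for j
    proof -
      have "j = 1" using that by auto
      then show ?thesis using ng[of w] d cv by simp
    qed
    ultimately have "nonflat_chain G i 2 c" unfolding nonflat_chain_def by blast
    then show "w \<in> W G i" unfolding W_def using cv by (intro CollectI exI[of _ 2] exI[of _ c]) auto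
  qed
qed

section \<open>From the axioms to involutions\<close>

definition step :: "'v scgraph \<Rightarrow> nat \<Rightarrow> 'v \<Rightarrow> 'v" where
  "step G j v = (if has_nbr G j v then nbr G j v else v)"

locale local_axioms =
  fixes G :: "'v scgraph" and i :: nat
  assumes scg: "signed_colored_graph G" and n_le: "type_n G \<le> type_N G"
    and axioms: "ax1 G" "ax2 G" "ax3 G" "ax5 G"
    and i: "1 < i" "i < type_n G"
    and r4: "ax4 (restriction i (type_N G) G)"
    and r6: "ax6 (restriction (i - 2) (type_N G) G)"
begin

abbreviation e where "e \<equiv> step G"

abbreviation s where "s \<equiv> sig G"

lemma edge_has_nbr:
  assumes "c \<in> edges G j" "v \<in> c" shows "has_nbr G j v" "v \<in> verts G" "1 < j" "j < type_n G"
proof -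
  show v: "v \<in> verts G" using scg assms unfolding signed_colored_graph_def by blast
  show j: "1 < j" "j < type_n G" using scg assms unfolding signed_colored_graph_def by blast+
  show "has_nbr G j v" using axioms(1) v j assms unfolding ax1_def has_nbr_def by blast
qed

lemma edge_iff: "{v, x} \<in> edges G j \<longleftrightarrow> x \<noteq> v \<and> e j v = x"
proof
  assume a: "{v, x} \<in> edges G j"
  have "has_nbr G j v" using edge_has_nbr(1)[OF a] by simp
  then have "y = x" if "{v, y} \<in> edges G j" for y
    using a that unfolding has_nbr_def by (metis doubleton_eq_iff insertI1)
  then have "nbr G j v = x" using a unfolding nbr_def by blast
  moreover have "card {v, x} = 2" using scg a unfolding signed_colored_graph_def by blast
  ultimately show "x \<noteq> v \<and> e j v = x" using \<open>has_nbr G j v\<close> by (auto simp: step_def)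
next
  assume a: "x \<noteq> v \<and> e j v = x"
  then have h: "has_nbr G j v" and x: "nbr G j v = x" by (auto simp: step_def split: if_splits)
  obtain c where c: "c \<in> edges G j" "v \<in> c" and u: "\<And>c'. c' \<in> edges G j \<Longrightarrow> v \<in> c' \<Longrightarrow> c' = c"
    using h unfolding has_nbr_def by blast
  have "card c = 2" using scg c unfolding signed_colored_graph_def by blast
  then obtain p q where pq: "c = {p, q}" "p \<noteq> q" by (auto simp: card_2_iff)
  then obtain y where y: "c = {v, y}" using c by auto
  have "nbr G j v = y"
    unfolding nbr_def by (rule the_equality) (use c y u in \<open>auto simp: doubleton_eq_iff\<close>)
  then show "{v, x} \<in> edges G j" using x y c by simp
qed

lemma e_inv: "e j (e j v) = v"
proof (cases "e j v = v")
  case False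
  then have "{e j v, v} \<in> edges G j" using edge_iff[of v "e j v" j] by (simp add: insert_commute)
  then show ?thesis by (simp only: edge_iff)
qed simp

lemma edges_matching: "edges G j = {{v, e j v} | v. e j v \<noteq> v}"
proof -
  have "c \<in> {{v, e j v} | v. e j v \<noteq> v}" if "c \<in> edges G j" for c
  proof -
    have "card c = 2" using scg that unfolding signed_colored_graph_def by blast
    then obtain p q where c: "c = {p, q}" by (auto simp: card_2_iff)
    then have "{p, q} \<in> edges G j" using that by simp
    then have "q \<noteq> p" "q = e j p" unfolding edge_iff by auto
    then have "c = {p, e j p} \<and> e j p \<noteq> p" using c by metis
    then show ?thesis by (intro CollectI exI)
  qed
  moreover have "{v, e j v} \<in> edges G j" if "e j v \<noteq> v" for v using that by (simp only: edge_iff) simp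
  ultimately show ?thesis by blast
qed

lemma has_nbr_iff: "has_nbr G j v \<longleftrightarrow> e j v \<noteq> v"
  using matching_has_nbr[OF edges_matching e_inv] .

lemma nbr_eq: "e j v \<noteq> v \<Longrightarrow> nbr G j v = e j v"
  using matching_nbr[OF edges_matching e_inv] .

lemma move_in:
  assumes "e j v \<noteq> v" shows "v \<in> verts G" "e j v \<in> verts G" "1 < j" "j < type_n G"
  using edge_has_nbr[of "{v, e j v}" j] assms edge_iff by auto

lemma e_closed: "v \<in> verts G \<Longrightarrow> e j v \<in> verts G"
  using move_in(2)[of j v] by (cases "e j v = v") auto

lemma move_iff: "v \<in> verts G \<Longrightarrow> 1 < j \<Longrightarrow> j < type_n G \<Longrightarrow> e j v \<noteq> v \<longleftrightarrow> s v (j - 1) = - s v j"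
proof -
  assume a: "v \<in> verts G" "1 < j" "j < type_n G"
  then have "s v (j - 1) = - s v j \<longleftrightarrow> (\<exists>c \<in> edges G j. v \<in> c)" using axioms(1) unfolding ax1_def by blast
  also have "\<dots> \<longleftrightarrow> e j v \<noteq> v" using matching_edge_iff[OF edges_matching e_inv] by blast
  finally show ?thesis by simp
qed

lemma s_sign: "v \<in> verts G \<Longrightarrow> 1 \<le> h \<Longrightarrow> h < type_N G \<Longrightarrow> s v h = 1 \<or> s v h = - 1"
  using scg unfolding signed_colored_graph_def by (metis empty_iff insert_iff)

lemma s_outside: "v \<in> verts G \<Longrightarrow> \<not> (1 \<le> h \<and> h < type_N G) \<Longrightarrow> s v h = 0"
  using scg unfolding signed_colored_graph_def by auto

lemma s_flip: "e j v \<noteq> v \<Longrightarrow> s (e j v) (j - 1) = - s v (j - 1) \<and> s (e j v) j = - s v j"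
proof -
  assume a: "e j v \<noteq> v"
  then have "{v, e j v} \<in> edges G j" using edge_iff by auto
  then have "s v (j - 1) = - s (e j v) (j - 1) \<and> s v j = - s (e j v) j"
    using axioms(2) move_in(3,4)[OF a] unfolding ax2_def by blast
  then show ?thesis by simp
qed

lemma s_far: "v \<in> verts G \<Longrightarrow> h + 2 < j \<or> j + 1 < h \<Longrightarrow> s (e j v) h = s v h"
proof -
  assume a: "v \<in> verts G" "h + 2 < j \<or> j + 1 < h"
  show ?thesis
  proof (cases "e j v \<noteq> v \<and> 1 \<le> h \<and> h < type_N G")
    case True
    then have "{v, e j v} \<in> edges G j" using edge_iff by auto
    then have "s v h = s (e j v) h"
      using axioms(2) move_in(3,4)[of j v] a True unfolding ax2_def by blast
    then show ?thesis by simp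
  next
    case False
    \<comment> \<open>Entries outside the signature are 0 at every vertex, so the equation holds for
      those \<open>h\<close> too.\<close>
    then show ?thesis using s_outside[of v h] s_outside[of "e j v" h] e_closed a by (cases "e j v = v") auto
  qed
qed

text \<open>The entries \<open>j - 1\<close> and \<open>j\<close> decide whether color
  \<open>j\<close> acts, and a far color touches neither.\<close>

lemma far_moves:
  assumes "far j k" "e j v \<noteq> v" shows "e j (e k v) \<noteq> e k v"
proof -
  note m = move_in[OF assms(2)]
  have "s (e k v) (j - 1) = s v (j - 1)" "s (e k v) j = s v j"
    by (rule s_far[OF m(1)]; use assms(1) m(3) in \<open>auto simp: far_def\<close>)+
  then show ?thesis using move_iff[OF m(1,3,4)] move_iff[OF e_closed[OF m(1)] m(3,4), of k] assms(2) by simp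
qed

text \<open>(ax5) completes the square when both colors act; the remaining cases follow from
  \<open>far_moves\<close>.\<close>

lemma e_commute:
  assumes "far j k" shows "e j (e k v) = e k (e j v)"
proof (cases "e j v = v")
  case True
  have "e j (e k v) = e k v" using far_moves[OF assms, of "e k v"] e_inv True by metis
  then show ?thesis using True by simp
next
  case mj: False
  show ?thesis
  proof (cases "e k v = v")
    case True
    have "e k (e j v) = e j v"
      using far_moves[of k j "e j v"] assms e_inv True by (metis far_def)
    then show ?thesis using True by simp
  next
    case False
    have "{e k v, v} \<in> edges G k" using edge_iff[of v "e k v" k] False by (simp add: insert_commute)
    moreover have "{v, e j v} \<in> edges G j" using edge_iff mj by auto
    ultimately obtain x where "{e k v, x} \<in> edges G j" "{x, e j v} \<in> edges G k"
      using axioms(4) assms unfolding ax5_def far_def by blast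
    then have "e j (e k v) = x" "e k x = e j v" using edge_iff by auto
    then show ?thesis using e_inv by metis
  qed
qed

text \<open>Stated for a second graph \<open>H\<close> to cover restrictions. A letter without an
  edge acts trivially, so all words are allowed.\<close>

lemma component_walk:
  assumes v: "v \<in> verts G" and E: "verts H = verts G" "\<And>j. j \<in> J \<Longrightarrow> edges H j = edges G j"
  shows "component_of H J v = (\<lambda>ws. foldr e ws v) ` lists J"
proof -
  let ?R = "{(a, b). \<exists>j \<in> J. {a, b} \<in> edges H j}"
  have closed: "foldr e ws v \<in> verts G" for ws by (induction ws) (auto simp: v e_closed)
  have "(v, foldr e ws v) \<in> ?R\<^sup>*" if "ws \<in> lists J" for ws
    using that
  proof (induction ws)
    case (Cons j ws)
    show ?case
    proof (cases "e j (foldr e ws v) = foldr e ws v")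
      case False
      then have "(foldr e ws v, e j (foldr e ws v)) \<in> ?R" using Cons(1) E(2) edge_iff by auto
      then show ?thesis using Cons by (auto intro: rtrancl_into_rtrancl)
    qed (use Cons in auto)
  qed simp
  moreover have "\<exists>ws \<in> lists J. x = foldr e ws v" if "(v, x) \<in> ?R\<^sup>*" for x
    using that
  proof (induction rule: rtrancl_induct)
    case base then show ?case by (intro bexI[of _ "[]"]) auto
  next
    case (step y z)
    then obtain ws j where "ws \<in> lists J" "y = foldr e ws v" "j \<in> J" "{y, z} \<in> edges H j" by auto
    then have "z = foldr e (j # ws) v" "j # ws \<in> lists J" using E(2) edge_iff by auto
    then show ?case by blast
  qed
  ultimately show ?thesis using closed unfolding component_of_def E(1) by auto
qed

lemma path_walk:
  assumes "length vs = length cs + 1" "\<And>k. k < length cs \<Longrightarrow> {vs ! k, vs ! Suc k} \<in> edges G (cs ! k)"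
  shows "last vs = foldr e (rev cs) (hd vs)"
  using assms
proof (induction cs arbitrary: vs)
  case Nil
  then obtain v where "vs = [v]" by (metis Suc_eq_plus1 length_0_conv length_Suc_conv list.size(3))
  then show ?case by simp
next
  case (Cons c cs)
  then obtain v us where vs: "vs = v # us" "length us = length cs + 1"
    by (metis Suc_eq_plus1 length_Suc_conv)
  then have "us \<noteq> []" by auto
  have "last us = foldr e (rev cs) (hd us)"
    using Cons.IH[OF vs(2)] Cons.prems(2)[of "Suc _"] vs by simp
  moreover have "e c v = hd us"
    using Cons.prems(2)[of 0] vs edge_iff \<open>us \<noteq> []\<close> by (simp add: hd_conv_nth)
  ultimately show ?case using vs \<open>us \<noteq> []\<close> by simp
qed

text \<open>(ax6) for the restriction provides a path using color \<open>c\<close> at most once; its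
  list of colors is split there, and reversed because the last letter of a word acts first.\<close>

lemma one_top_step:
  assumes v: "v \<in> verts G" and c: "2 \<le> c" "c + 2 < i" and ws: "ws \<in> lists {2..c}"
  shows "(\<exists>as \<in> lists {2..c - 1}. foldr e ws v = foldr e as v) \<or>
      (\<exists>as \<in> lists {2..c - 1}. \<exists>bs \<in> lists {2..c - 1}. foldr e ws v = foldr e as (e c (foldr e bs v)))"
proof -
  let ?H = "restriction (i - 2) (type_N G) G"
  have E: "verts ?H = verts G" "\<And>j. j \<in> {2..c} \<Longrightarrow> edges ?H j = edges G j" "type_n ?H = i - 2"
    using c by (auto simp: restriction_def)
  let ?C = "component_of ?H {2..c} v"
  note C = component_walk[of v ?H "{2..c}", OF v E(1,2)]
  have "is_component ?H {2..c} ?C" using v E by (auto simp: is_component_def)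
  moreover have "v \<in> ?C" using C by (force intro: image_eqI[of _ _ "[]"])
  moreover have "foldr e ws v \<in> ?C" using C ws by auto
  moreover have "1 < c" "c < type_n ?H" using c E by auto
  ultimately obtain vs cs where p: "colored_path ?H {2..c} vs cs" "hd vs = v" "last vs = foldr e ws v"
    "count_list cs c \<le> 1"
    using r6 unfolding ax6_def by blast
  have cs: "set cs \<subseteq> {2..c}" using p(1) by (auto simp: colored_path_def in_set_conv_nth)
  have "{vs ! k, vs ! Suc k} \<in> edges G (cs ! k)" if "k < length cs" for k
    using p(1) that E(2) cs by (auto simp: colored_path_def)
  then have w: "foldr e ws v = foldr e (rev cs) v"
    using path_walk[of vs cs] p by (simp add: colored_path_def)
  have sub: "us \<in> lists {2..c - 1}" if "set us \<subseteq> {2..c}" "c \<notin> set us" for us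
  proof -
    have "x \<in> {2..c - 1}" if "x \<in> set us" for x
    proof -
      have "x \<noteq> c" "2 \<le> x" "x \<le> c" using that \<open>set us \<subseteq> _\<close> \<open>c \<notin> set us\<close> by auto
      then show ?thesis by auto
    qed
    then show ?thesis by (auto simp: in_lists_conv_set)
  qed
  show ?thesis
  proof (cases "c \<in> set cs")
    case False
    then show ?thesis using w sub[of "rev cs"] cs by (auto intro!: disjI1 bexI[of _ "rev cs"])
  next
    case True
    then obtain xs ys where xy: "cs = xs @ c # ys" by (auto simp: in_set_conv_decomp)
    then have "c \<notin> set xs" "c \<notin> set ys" using p(4) by (auto simp: count_list_0_iff)
    then have "rev ys \<in> lists {2..c - 1}" "rev xs \<in> lists {2..c - 1}" using sub[of "rev ys"] sub[of "rev xs"] cs xy by auto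
    then show ?thesis using w xy by (intro disjI2 bexI[of _ "rev ys"] bexI[of _ "rev xs"]) auto
  qed
qed

section \<open>Components in two and three colors\<close>

lemma component_moves:
  assumes v: "v \<in> verts G" and J: "\<forall>j \<in> J. 1 < j \<and> j < i"
  defines "H \<equiv> restriction i (type_N G) G"
  defines "C \<equiv> component_of H J v"
  shows "is_component H J C" "v \<in> C" "\<And>x j. x \<in> C \<Longrightarrow> j \<in> J \<Longrightarrow> e j x \<in> C"
    "\<And>j. j \<in> J \<Longrightarrow> edges_in H j C = {{x, e j x} | x. x \<in> C \<and> e j x \<noteq> x}"
proof -
  have E: "verts H = verts G" "\<And>j. j \<in> J \<Longrightarrow> edges H j = edges G j"
    using J by (auto simp: H_def restriction_def)
  have C: "C = (\<lambda>ws. foldr e ws v) ` lists J" unfolding C_def by (rule component_walk[OF v E])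
  show "is_component H J C" using v E by (auto simp: is_component_def C_def)
  show "v \<in> C" unfolding C by (rule image_eqI[of _ _ "[]"]) auto
  show cl: "e j x \<in> C" if "x \<in> C" "j \<in> J" for x j
  proof -
    obtain ws where ws: "ws \<in> lists J" "x = foldr e ws v" using \<open>x \<in> C\<close> unfolding C by (rule imageE)
    show ?thesis unfolding C by (rule image_eqI[of _ _ "j # ws"]) (use ws \<open>j \<in> J\<close> in auto)
  qed
  show "edges_in H j C = {{x, e j x} | x. x \<in> C \<and> e j x \<noteq> x}" if "j \<in> J" for j
  proof -
    have "c \<in> edges_in H j C \<longleftrightarrow> (\<exists>x. c = {x, e j x} \<and> x \<in> C \<and> e j x \<noteq> x)" for c
    proof
      assume "c \<in> edges_in H j C"
      then have "c \<in> {{v, e j v} | v. e j v \<noteq> v}" "c \<subseteq> C"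
        unfolding edges_in_def E(2)[OF that] edges_matching[symmetric] by auto
      then show "\<exists>x. c = {x, e j x} \<and> x \<in> C \<and> e j x \<noteq> x" by blast
    next
      assume "\<exists>x. c = {x, e j x} \<and> x \<in> C \<and> e j x \<noteq> x"
      then obtain x where x: "c = {x, e j x}" "x \<in> C" "e j x \<noteq> x" by blast
      then have "c \<in> edges G j" by (simp add: edge_iff)
      then show "c \<in> edges_in H j C"
        using x cl[OF x(2) that] unfolding edges_in_def E(2)[OF that] by simp
    qed
    then show ?thesis by blast
  qed
qed

lemma matched:
  assumes "X = {{x, e j x} | x. x \<in> C \<and> e j x \<noteq> x}"
  shows "{p, q} \<in> X \<Longrightarrow> e j p = q \<and> e j q = p" "x \<in> C \<Longrightarrow> x \<notin> \<Union> X \<Longrightarrow> e j x = x"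
proof -
  show "e j p = q \<and> e j q = p" if "{p, q} \<in> X"
    using that e_inv[of j p] e_inv[of j q] unfolding assms by (auto simp: doubleton_eq_iff)
  show "e j x = x" if "x \<in> C" "x \<notin> \<Union> X" using that unfolding assms by blast
qed

text \<open>A vertex on edges of both colors is the middle of a three-vertex path or an end of a
  double edge.\<close>

lemma two_colors:
  assumes v: "v \<in> verts G" and j: "3 \<le> j" "j < i" and m: "e (j - 1) v \<noteq> v" "e j v \<noteq> v"
  shows "e j v = e (j - 1) v \<or> e j (e (j - 1) v) = e (j - 1) v \<and> e (j - 1) (e j v) = e j v"
proof -
  let ?H = "restriction i (type_N G) G" and ?J = "{j - 1, j}"
  define C where "C = component_of ?H ?J v"
  have J: "\<forall>k \<in> ?J. 1 < k \<and> k < i" using j by auto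
  note cm = component_moves[of v ?J, OF v J, folded C_def]
  have n: "type_n ?H = i" by (simp add: restriction_def)
  have "two_color_component ?H j C" using r4 cm(1) j unfolding ax4_def n by blast
  then show ?thesis
    unfolding two_color_component_def
  proof (elim disjE exE conjE)
    fix p assume "C = {p}"
    then show ?thesis using cm(2) cm(3)[of v j] m by auto
  next
    fix p q r assume d: "distinct [p, q, r]" and C: "C = {p, q, r}"
      and E: "edges_in ?H (j - 1) C = {{p, q}}" "edges_in ?H j C = {{q, r}}"
    note M = matched[OF trans[OF E(1)[symmetric] cm(4)]] matched[OF trans[OF E(2)[symmetric] cm(4)]]
    have "e (j - 1) p = q" "e (j - 1) q = p" "e j q = r" "e j r = q" "e (j - 1) r = r" "e j p = p"
      using M(1)[of p q] M(2)[of r] M(3)[of q r] M(4)[of p] d C by auto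
    moreover have "v = p \<or> v = q \<or> v = r" using cm(2) C by auto
    ultimately show ?thesis using m by auto
  next
    fix p q assume d: "distinct [p, q]" and C: "C = {p, q}"
      and E: "edges_in ?H (j - 1) C = {{p, q}}" "edges_in ?H j C = {{p, q}}"
    note M = matched[OF trans[OF E(1)[symmetric] cm(4)]] matched[OF trans[OF E(2)[symmetric] cm(4)]]
    have "e (j - 1) p = q" "e (j - 1) q = p" "e j p = q" "e j q = p"
      using M(1)[of p q] M(3)[of p q] by auto
    moreover have "v = p \<or> v = q" using cm(2) C by auto
    ultimately show ?thesis by auto
  qed
qed

text \<open>(ax3), applied from both ends, makes color \<open>j\<close> act at both ends of the
  \<open>(j - 1)\<close>-edge, and \<open>two_colors\<close> then leaves only the double
  edge.\<close>

lemma double_up: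
  assumes v: "v \<in> verts G" and j: "3 \<le> j" "j < i" and fl: "s (e (j - 1) v) j \<noteq> s v j"
  shows "e j v = e (j - 1) v"
proof -
  let ?y = "e (j - 1) v"
  have y: "?y \<noteq> v" using fl by auto
  have yV: "?y \<in> verts G" using e_closed[OF v] .
  have jn: "j < type_N G" using j i n_le by linarith
  have sg: "s v j = - s ?y j" using s_sign[OF v, of j] s_sign[OF yV, of j] fl jn j by auto
  have ax: "s a j = - s a (j - 1)" if "{a, b} \<in> edges G (j - 1)" "s a j = - s b j" for a b
  proof -
    have "1 < j - 1" "j - 1 < type_n G" "j - 1 + 1 = j" using j i by auto
    then show ?thesis using axioms(3) that jn unfolding ax3_def by metis
  qed
  have ed: "{v, ?y} \<in> edges G (j - 1)" "{?y, v} \<in> edges G (j - 1)"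
    using y edge_iff[of v ?y "j-1"] by (auto simp: insert_commute)
  have j2: "1 < j" "j < type_n G" using j i by auto
  have "e j v \<noteq> v" using ax[OF ed(1) sg] move_iff[OF v j2] by simp
  moreover have "e j ?y \<noteq> ?y" using ax[OF ed(2)] sg move_iff[OF yV j2] by simp
  ultimately show ?thesis using two_colors[OF v j y] by auto
qed

text \<open>The mirror argument: (ax3) makes color \<open>j - 1\<close> act at both ends of the
  \<open>j\<close>-edge.\<close>

lemma double_down:
  assumes v: "v \<in> verts G" and j: "3 \<le> j" "j < i" and fl: "s (e j v) (j - 2) \<noteq> s v (j - 2)"
  shows "e j v = e (j - 1) v"
proof -
  let ?y = "e j v"
  have y: "?y \<noteq> v" using fl by auto
  have yV: "?y \<in> verts G" using e_closed[OF v] .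
  have j2: "1 < j" "j < type_n G" "1 < j - 1" "j - 1 < type_n G" "j - 1 - 1 = j - 2" using j i by auto
  have "1 \<le> j - 2" "j - 2 < type_N G" using j i n_le by linarith+
  then have sg: "s v (j - 2) = - s ?y (j - 2)" using s_sign[OF v, of "j-2"] s_sign[OF yV, of "j-2"] fl by auto
  have ax: "s a (j - 2) = - s a (j - 1)" if "{a, b} \<in> edges G j" "s a (j - 2) = - s b (j - 2)" for a b
    using axioms(3) that j j2(1,2) unfolding ax3_def by metis
  have ed: "{v, ?y} \<in> edges G j" "{?y, v} \<in> edges G j"
    using y edge_iff[of v ?y j] by (auto simp: insert_commute)
  have "e (j - 1) v \<noteq> v" using ax[OF ed(1) sg] move_iff[OF v j2(3,4)] j2(5) by simp
  moreover have "e (j - 1) ?y \<noteq> ?y" using ax[OF ed(2)] sg move_iff[OF yV j2(3,4)] j2(5) by simp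
  ultimately show ?thesis using two_colors[OF v j _ y] by auto
qed

text \<open>Edges of colors \<open>j - 2\<close> and \<open>j\<close> meet only in the five- and
  six-vertex components. In the former they meet at \<open>b\<close>, \<open>c\<close> and
  \<open>d\<close>, and \<open>d\<close> lies on a double edge excluded by
  \<open>nd\<close>.\<close>

lemma three_colors:
  assumes v: "v \<in> verts G" and j: "4 \<le> j" "j < i"
    and m: "e (j - 2) v \<noteq> v" "e j v \<noteq> v" and nd: "e j v \<noteq> e (j - 1) v"
  shows "(e (j - 2) (e j v) = e j (e (j - 2) v) \<and> e j (e (j - 2) v) \<notin> {e (j - 2) v, e (j - 1) (e (j - 2) v)}) \<or>
      (e j (e (j - 2) v) \<in> {e (j - 2) v, e (j - 1) (e (j - 2) v)} \<and>
       e j (e (j - 2) (e j v)) \<in> {e (j - 2) (e j v), e (j - 1) (e (j - 2) (e j v))} \<and>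
       s (e (j - 2) (e j v)) (j - 1) = s (e (j - 2) v) (j - 1))"
proof -
  let ?H = "restriction i (type_N G) G" and ?J = "{j - 2, j - 1, j}"
  define C where "C = component_of ?H ?J v"
  have J: "\<forall>k \<in> ?J. 1 < k \<and> k < i" using j by auto
  note cm = component_moves[of v ?J, OF v J, folded C_def]
  have n: "type_n ?H = i" by (simp add: restriction_def)
  have "three_color_component ?H j C" using r4 cm(1) j unfolding ax4_def n by blast
  then show ?thesis
    unfolding three_color_component_def
  proof (elim disjE exE conjE)
    fix p assume "C = {p}"
    then show ?thesis using cm(2) cm(3)[of v j] m by auto
  next
    fix p q r t assume d: "distinct [p, q, r, t]" and C: "C = {p, q, r, t}"
      and E: "edges_in ?H (j - 2) C = {{p, q}}" "edges_in ?H (j - 1) C = {{q, r}}" "edges_in ?H j C = {{r, t}}"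
    note M = matched(2)[OF trans[OF E(1)[symmetric] cm(4)]] matched(2)[OF trans[OF E(3)[symmetric] cm(4)]]
    have "e (j - 2) r = r" "e (j - 2) t = t" "e j p = p" "e j q = q"
      using M(1)[of r] M(1)[of t] M(2)[of p] M(2)[of q] d C by auto
    moreover have "v = p \<or> v = q \<or> v = r \<or> v = t" using cm(2) C by auto
    ultimately show ?thesis using m by auto
  next
    fix a b c d x assume di: "distinct [a, b, c, d, x]" and C: "C = {a, b, c, d, x}"
      and E: "edges_in ?H (j - 2) C = {{a, b}, {c, d}}" "edges_in ?H (j - 1) C = {{a, b}, {d, x}}"
        "edges_in ?H j C = {{b, c}, {d, x}}"
    note M2 = matched[OF trans[OF E(1)[symmetric] cm(4)]]
      and M1 = matched[OF trans[OF E(2)[symmetric] cm(4)]]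
      and M0 = matched[OF trans[OF E(3)[symmetric] cm(4)]]
    have e2: "e (j - 2) a = b" "e (j - 2) b = a" "e (j - 2) c = d" "e (j - 2) d = c" "e (j - 2) x = x"
      using M2(1)[of a b] M2(1)[of c d] M2(2)[of x] di C by auto
    have e1: "e (j - 1) a = b" "e (j - 1) b = a" "e (j - 1) c = c" "e (j - 1) d = x" "e (j - 1) x = d"
      using M1(1)[of a b] M1(1)[of d x] M1(2)[of c] di C by auto
    have e0: "e j a = a" "e j b = c" "e j c = b" "e j d = x" "e j x = d"
      using M0(1)[of b c] M0(1)[of d x] M0(2)[of a] di C by auto
    have ne: "a \<noteq> b" "b \<noteq> c" "c \<noteq> d" "d \<noteq> x" using di by auto
    have V: "a \<in> verts G" "b \<in> verts G" "c \<in> verts G" "d \<in> verts G"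
      using C by (auto simp: C_def component_of_def restriction_def)
    have jj: "1 < j" "j < type_n G" and jlt: "j - 2 + 1 < j" using j i by auto
    \<comment> \<open>Along \<open>a\<close>, \<open>b\<close>, \<open>c\<close>, \<open>d\<close>
      entry \<open>j\<close> is flipped only between \<open>b\<close> and \<open>c\<close>. Color
      \<open>j\<close> is idle at \<open>a\<close> and acts at \<open>d\<close>, so entry
      \<open>j - 1\<close> equals entry \<open>j\<close> at \<open>a\<close> and is its negative at
      \<open>d\<close>.\<close>
    have "s d (j - 1) = - s d j" using move_iff[OF V(4) jj] e0 ne by simp
    moreover have "s c j = s d j" using jlt s_far[OF V(4), of j "j-2"] e2 by simp
    moreover have "s c j = - s b j" using s_flip[of j b] e0 ne by simp
    moreover have "s b j = s a j" using jlt s_far[OF V(1), of j "j-2"] e2 by simp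
    moreover have "s a (j - 1) = s a j"
    proof -
      have "s a (j - 1) \<noteq> - s a j" using move_iff[OF V(1) jj] e0 by simp
      moreover have "j - 1 < type_N G" "1 \<le> j - 1" "j < type_N G" using j i n_le by linarith+
      ultimately show ?thesis using s_sign[OF V(1), of j] s_sign[OF V(1), of "j-1"] j by auto
    qed
    ultimately have sg: "s a (j - 1) = s d (j - 1)" by simp
    have "v = a \<or> v = b \<or> v = c \<or> v = d \<or> v = x" using cm(2) C by auto
    then show ?thesis
    proof (elim disjE)
      assume "v = a" then show ?thesis using m e0 by simp
    next
      assume "v = b" then show ?thesis using e0 e1 e2 sg by simp
    next
      assume "v = c" then show ?thesis using e0 e1 e2 sg by simp
    next
      assume "v = d" then show ?thesis using nd e0 e1 by simp
    next
      assume "v = x" then show ?thesis using nd e0 e1 by simp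
    qed
  next
    fix p q r x y z assume di: "distinct [p, q, r, x, y, z]" and C: "C = {p, q, r, x, y, z}"
      and E: "edges_in ?H (j - 2) C = {{q, r}, {x, y}}" "edges_in ?H (j - 1) C = {{p, q}, {y, z}}"
        "edges_in ?H j C = {{q, x}, {r, y}}"
    note M2 = matched[OF trans[OF E(1)[symmetric] cm(4)]]
      and M1 = matched[OF trans[OF E(2)[symmetric] cm(4)]]
      and M0 = matched[OF trans[OF E(3)[symmetric] cm(4)]]
    have e2: "e (j - 2) q = r" "e (j - 2) r = q" "e (j - 2) x = y" "e (j - 2) y = x"
      "e (j - 2) p = p" "e (j - 2) z = z"
      using M2(1)[of q r] M2(1)[of x y] M2(2)[of p] M2(2)[of z] di C by auto
    have e1: "e (j - 1) p = q" "e (j - 1) q = p" "e (j - 1) y = z" "e (j - 1) z = y"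
      "e (j - 1) r = r" "e (j - 1) x = x"
      using M1(1)[of p q] M1(1)[of y z] M1(2)[of r] M1(2)[of x] di C by auto
    have e0: "e j q = x" "e j x = q" "e j r = y" "e j y = r"
      using M0(1)[of q x] M0(1)[of r y] by auto
    have "v = p \<or> v = q \<or> v = r \<or> v = x \<or> v = y \<or> v = z" using cm(2) C by auto
    then show ?thesis
    proof (elim disjE)
      assume "v = p" then show ?thesis using m e2 by simp
    next
      assume "v = q" then show ?thesis using e0 e1 e2 di by auto
    next
      assume "v = r" then show ?thesis using e0 e1 e2 di by auto
    next
      assume "v = x" then show ?thesis using e0 e1 e2 di by auto
    next
      assume "v = y" then show ?thesis using e0 e1 e2 di by auto
    next
      assume "v = z" then show ?thesis using m e2 by simp
    qed
  qed
qed

section \<open>Packages and the rewired graph in terms of the involutions\<close>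

sublocale F: flip_graph "verts G" s e "type_n G" i
proof
  show "i < type_n G" using i by simp
  show "e j v = v" if "\<not> (1 < j \<and> j < type_n G)" for j v using move_in(3,4)[of j v] that by blast
  show "s v h = 1 \<or> s v h = - 1" if "v \<in> verts G" "1 \<le> h" "h < type_n G" for v h
    using s_sign[OF that(1,2)] that(3) n_le by simp
  show "s (e j v) (j - 1) = - s v (j - 1) \<and> s (e j v) j = - s v j" if "v \<in> verts G" "e j v \<noteq> v" for v j
    using s_flip that(2) .
qed (fact e_closed e_inv move_iff s_far e_commute double_up double_down three_colors one_top_step)+

lemma W_eq: "W G i = F.switching"
  unfolding F.switching_def by (rule W_matching[OF edges_matching e_inv edges_matching e_inv e_closed e_closed])

lemma package_eq: "v \<in> verts G \<Longrightarrow> package G k v = (\<lambda>ws. foldr e ws v) ` lists (package_colors G k)"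
  unfolding package_def by (rule component_walk) auto

lemma outer_eq: "package_colors G i = F.outer"
  by (auto simp: package_colors_def F.outer_def far_def)

lemma package_orbit: "v \<in> verts G \<Longrightarrow> package G i v = F.orbit v"
  by (simp add: package_eq F.orbit_def outer_eq)

text \<open>Color \<open>i - 1\<close> commutes with the letters of the
  \<open>(i - 1)\<close>-package, so its edge persists there, and \<open>switching_flat\<close>
  makes it flat.\<close>

lemma W0_eq: "W0 G i = W G i"
proof -
  have "has_flat_edge G (i - 1) v" if w: "w \<in> F.switching" and v: "v \<in> package G (i - 1) w" for w v
  proof -
    note wD = F.switchingD[OF w]
    obtain ws where ws: "ws \<in> lists (package_colors G (i - 1))" "v = foldr e ws w"
      using v package_eq[OF wD(1)] by auto
    have f: "\<forall>j \<in> set ws. 1 < j \<and> far j (i - 1)" using ws by (auto simp: package_colors_def far_def)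
    have "e (i - 1) v = foldr e ws (e (i - 1) w)" unfolding ws(2) by (rule F.walk_commute) (use f in auto)
    moreover have "foldr e ws (e (i - 1) w) \<noteq> foldr e ws w" using wD(4) F.walk_rev[of ws] by metis
    ultimately have mv: "e (i - 1) v \<noteq> v" using ws by simp
    have "i - 1 - 2 = i - 3" by simp
    then show ?thesis
      using mv nbr_eq[OF mv] F.switching_flat[OF w _ f] ws(2)
      unfolding has_flat_edge_def has_nbr_iff by auto
  qed
  then show ?thesis unfolding W0_def W_eq by auto
qed

text \<open>Preserving and reflecting edges forces commutation with every package color, so the
  value at \<open>w\<close> determines the map; this yields uniqueness.\<close>

lemma phi_iso_walk:
  assumes w: "w \<in> F.switching" and g: "is_phi_iso G i w g" and ws: "ws \<in> lists F.outer"
  shows "g (foldr e ws w) = foldr e ws (e (i - 1) w)"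
proof -
  note wD = F.switchingD[OF w]
  have P: "package G i w = F.orbit w" "package G i (e (i - 1) w) = F.orbit (e (i - 1) w)" "nbr G (i - 1) w = e (i - 1) w"
    using package_orbit wD(1) e_closed nbr_eq wD(4) by auto
  have bij: "bij_betw g (F.orbit w) (F.orbit (e (i - 1) w))" and gw: "g w = e (i - 1) w"
    and ed: "\<And>j a b. j \<in> F.outer \<Longrightarrow> a \<in> F.orbit w \<Longrightarrow> b \<in> F.orbit w \<Longrightarrow>
        {a, b} \<in> edges G j \<longleftrightarrow> {g a, g b} \<in> edges G j"
    using g unfolding is_phi_iso_def package_iso_def P outer_eq by auto
  show ?thesis
    using ws
  proof (induction ws)
    case Nil then show ?case using gw by simp
  next
    case (Cons j ws)
    let ?a = "foldr e ws w"
    have j: "j \<in> F.outer" and IH: "g ?a = foldr e ws (e (i - 1) w)" using Cons by auto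
    have a: "?a \<in> F.orbit w" using Cons unfolding F.orbit_def by auto
    have ja: "e j ?a \<in> F.orbit w" using F.orbit_trans[OF a, of "[j]"] j by simp
    have "g (e j ?a) = e j (g ?a)"
    proof (cases "e j ?a = ?a")
      case True
      \<comment> \<open>An edge at \<open>g ?a\<close> stays in the second package, so its other end
        has a preimage, and reflection produces an edge at \<open>?a\<close>.\<close>
      have "e j (g ?a) = g ?a"
      proof (rule ccontr)
        assume m: "e j (g ?a) \<noteq> g ?a"
        have "g ?a \<in> F.orbit (e (i - 1) w)" using bij a by (auto simp: bij_betw_def)
        then have "e j (g ?a) \<in> F.orbit (e (i - 1) w)" using F.orbit_trans[of _ _ "[j]"] j by fastforce
        then obtain b where b: "b \<in> F.orbit w" "g b = e j (g ?a)"
          using bij unfolding bij_betw_def by (metis imageE)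
        then have "{g ?a, g b} \<in> edges G j" using m by (simp add: edge_iff)
        then have "{?a, b} \<in> edges G j" using ed[OF j a b(1)] by simp
        then show False using True unfolding edge_iff by auto
      qed
      then show ?thesis using True by simp
    next
      case False
      then have "{?a, e j ?a} \<in> edges G j" by (simp add: edge_iff)
      then have "{g ?a, g (e j ?a)} \<in> edges G j" using ed[OF j a ja] by simp
      then show ?thesis by (simp add: edge_iff)
    qed
    then show ?case using IH by simp
  qed
qed

lemma phi_iso_exists:
  assumes w: "w \<in> F.switching"
  shows "\<exists>!f. is_phi_iso G i w f"
proof -
  note wD = F.switchingD[OF w]
  let ?u = "e (i - 1) w"
  have P: "package G i w = F.orbit w" "package G i ?u = F.orbit ?u" "nbr G (i - 1) w = ?u"
    using package_orbit wD(1) e_closed nbr_eq wD(4) by auto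
  obtain f where f: "f \<in> extensional (F.orbit w)" "bij_betw f (F.orbit w) (F.orbit ?u)"
    "\<And>ws. ws \<in> lists F.outer \<Longrightarrow> f (foldr e ws w) = foldr e ws ?u" using F.orbit_iso_exists[OF w] by blast
  have inj: "inj_on f (F.orbit w)" using f(2) by (simp add: bij_betw_def)
  have fe: "f (e j a) = e j (f a)" if "j \<in> F.outer" "a \<in> F.orbit w" for j a
  proof -
    obtain ws where "ws \<in> lists F.outer" "a = foldr e ws w" using \<open>a \<in> _\<close> unfolding F.orbit_def by (rule imageE)
    then show ?thesis using f(3)[of ws] f(3)[of "j # ws"] \<open>j \<in> _\<close> by simp
  qed
  have "{a, b} \<in> edges G j \<longleftrightarrow> {f a, f b} \<in> edges G j"
    if j: "j \<in> F.outer" and a: "a \<in> F.orbit w" and b: "b \<in> F.orbit w" for j a b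
  proof -
    have ja: "e j a \<in> F.orbit w" using F.orbit_trans[OF a, of "[j]"] j by simp
    show ?thesis unfolding edge_iff fe[OF j a, symmetric]
      using inj_on_eq_iff[OF inj ja b] inj_on_eq_iff[OF inj b a] by simp
  qed
  moreover have "s (f a) j = s a j"
    if a: "a \<in> F.orbit w" and j: "1 \<le> j \<and> j < type_N G \<and> (j + 3 \<le> i \<or> i + 2 \<le> j)" for a j
  proof -
    obtain ws where ws: "ws \<in> lists F.outer" "a = foldr e ws w" using a unfolding F.orbit_def by (rule imageE)
    then show ?thesis using f(3)[OF ws(1)] F.s_outer_iso[OF w ws(1)] j by simp
  qed
  moreover have fw: "f w = ?u" using f(3)[of "[]"] by simp
  ultimately have iso: "is_phi_iso G i w f"
    unfolding is_phi_iso_def package_iso_def P outer_eq using f(1,2) by blast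
  have "g = f" if g: "is_phi_iso G i w g" for g
  proof (rule extensionalityI[of g "F.orbit w"])
    show "g \<in> extensional (F.orbit w)" using g unfolding is_phi_iso_def package_iso_def P by blast
    show "f \<in> extensional (F.orbit w)" by (rule f(1))
    fix a assume "a \<in> F.orbit w"
    then obtain ws where ws: "ws \<in> lists F.outer" "a = foldr e ws w" unfolding F.orbit_def by (rule imageE)
    then show "g a = f a" using phi_iso_walk[OF w g ws(1)] f(3)[OF ws(1)] by simp
  qed
  then show ?thesis using iso by blast
qed

text \<open>On vertices with an \<open>i\<close>-neighbour \<open>phi_map\<close> is the involution
  \<open>rewire\<close>, so the new \<open>i\<close>-edges again form a matching and
  \<open>W_matching\<close> applies to the new graph.\<close>

lemma phi_graph_props:
  assumes w: "w \<in> F.switching"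
  shows "phi_defined G i w" "W (phi_graph G i w) i \<subset> F.switching"
proof -
  note wD = F.switchingD[OF w]
  let ?u = "e (i - 1) w"
  define f where "f = phi_iso G i w"
  have P: "package G i w = F.orbit w" "package G i ?u = F.orbit ?u" "nbr G (i - 1) w = ?u"
    using package_orbit wD(1) e_closed nbr_eq wD(4) by auto
  have "is_phi_iso G i w f" unfolding f_def phi_iso_def using theI'[OF phi_iso_exists[OF w]] .
  then have bij: "bij_betw f (F.orbit w) (F.orbit ?u)" and fw: "f w = ?u"
    unfolding is_phi_iso_def package_iso_def P by auto
  note ctx = w bij fw
  define m where "m = F.rewire w f"
  have dom: "phi_dom G i w = F.dom w" unfolding phi_dom_def P F.dom_def[OF ctx] ..
  have swap: "phi_swap G i w = F.swap w f"
    by (rule ext) (simp add: phi_swap_def F.swap_def[OF ctx] P f_def[symmetric])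
  have dm: "has_nbr G i v" if "v \<in> F.dom w" for v using F.dom_moves[OF ctx that] has_nbr_iff by simp
  have map: "phi_map G i w v = m v" if "has_nbr G i v" for v
  proof -
    have v: "nbr G i v = e i v" using that nbr_eq has_nbr_iff by auto
    show ?thesis
    proof (cases "e i v \<in> F.dom w")
      case True
      then have "nbr G i (F.swap w f (e i v)) = e i (F.swap w f (e i v))"
        using F.swap[OF ctx True] F.dom_moves[OF ctx] nbr_eq by blast
      then show ?thesis using v unfolding phi_map_def m_def F.rewire_def[OF ctx] dom swap by auto
    next
      case False
      then show ?thesis using v unfolding phi_map_def m_def F.rewire_def[OF ctx] dom swap by auto
    qed
  qed
  have mm: "m (m v) = v" "m v \<noteq> v \<longleftrightarrow> has_nbr G i v" for v
    unfolding m_def using F.rewire_inv[OF ctx] F.rewire_moves[OF ctx] has_nbr_iff by auto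
  have mc: "m v \<in> verts G" if "v \<in> verts G" for v using F.rewire_closed[OF ctx that] by (simp add: m_def)
  let ?G = "phi_graph G i w"
  have "{{v, phi_map G i w v} | v. has_nbr G i v} = {{v, m v} | v. m v \<noteq> v}"
    unfolding mm(2) using map by metis
  then have E: "edges ?G i = {{v, m v} | v. m v \<noteq> v}" by (simp add: phi_graph_def)
  have G: "verts ?G = verts G" "\<And>j. j \<noteq> i \<Longrightarrow> edges ?G j = edges G j" "sig ?G = sig G"
    "type_n ?G = type_n G" "type_N ?G = type_N G"
    by (simp_all add: phi_graph_def)
  have E1: "edges ?G (i - 1) = {{v, e (i - 1) v} | v. e (i - 1) v \<noteq> v}"
    using G(2)[of "i-1"] i edges_matching[of "i-1"] by simp
  have vV: "v \<in> verts G" if "m v \<noteq> v" for v using that mm(2) has_nbr_iff move_in(1) by blast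
  have "c \<subseteq> verts G \<and> card c = 2" if "c \<in> edges ?G j" for c j
  proof (cases "j = i")
    case True
    then obtain v where "c = {v, m v}" "m v \<noteq> v" using \<open>c \<in> _\<close> E by blast
    then show ?thesis using vV mc by auto
  next
    case False
    then show ?thesis using \<open>c \<in> _\<close> G(2) scg unfolding signed_colored_graph_def by blast
  qed
  moreover have "edges ?G j = {}" if "\<not> (1 < j \<and> j < type_n G)" for j
    using that i G(2)[of j] scg unfolding signed_colored_graph_def by blast
  ultimately have scg': "signed_colored_graph ?G"
    using scg unfolding signed_colored_graph_def G(1,3,4,5) by blast
  have "has_nbr G i (phi_swap G i w (nbr G i v))" if "has_nbr G i v" "nbr G i v \<in> phi_dom G i w" for v
    using that(2) F.swap[OF ctx] dm unfolding dom swap by blast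
  then show "phi_defined G i w"
    unfolding phi_defined_def W0_eq W_eq using w phi_iso_exists[OF w] scg' by blast
  have "W ?G i = {x \<in> verts G. m x \<noteq> x \<and> e (i - 1) x \<noteq> x \<and> m (e (i - 1) x) \<noteq> e (i - 1) x \<and> m x \<noteq> e (i - 1) x}"
    using W_matching[OF E mm(1) E1 e_inv] mc e_closed unfolding G(1) by blast
  then show "W ?G i \<subset> F.switching" unfolding m_def using F.rewire_switching[OF ctx] by simp
qed

end

theorem theorem5p11:
  fixes G :: "'v scgraph" and n N i :: nat
  assumes "locally_schur_positive G" and "type_n G = n" and "type_N G = N"
    and "1 < i" and "i < n"
    and "dual_equivalence_graph (restriction (i - 2) N G)"
    and "ax4 (restriction i N G)"
  shows "W0 G i = W G i \<and>
    (\<forall>w \<in> W G i. phi_defined G i w \<and> W (phi_graph G i w) i \<subset> W G i)"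
proof -
  interpret local_axioms G i
    using assms unfolding locally_schur_positive_def dual_equivalence_graph_def by unfold_locales auto
  show ?thesis using W0_eq W_eq phi_graph_props by auto
qed

end
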